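(* Let $X$ be a normal variety with lt${}^+$ singularities such that $\mathfrak{D}(K_X)=\mathcal{O}_X$. Then $X$ has klt singularities.
   Context: All varieties are normal over $\mathbb{C}$. For a divisor $D$ on $X$, $\mathscr{R}(X,D):=\bigoplus_{m\geq1}\mathcal{O}_X(\lfloor mD\rfloor)$, with its natural graded $\mathcal{O}_X$-algebra structure ($\mathcal{O}_X$ being placed in degree $0$). Pullbacks of Weil divisors (de Fernex–Hacon). Let $f:Y\to X$ be a proper birational morphism of normal varieties. For a prime divisor $E$ on $Y$ and a coherent fractional ideal $\mathscr{I}$ on $X$, $\mathrm{val}_E(\mathscr{I}):=\min\{\mathrm{val}_E(\phi)\mid \phi\in\mathscr{I}(U),\ U\cap c_X(\mathrm{val}_E)\neq\emptyset\}$, where $c_X$ denotes the center on $X$. For a divisor $D$ on $X$, the $\natural$-pullback is $f^\natural D:=\sum_{E\subset Y}\mathrm{val}_E(\mathcal{O}_X(-D))\,E$; equivalently $\mathcal{O}_Y(-f^\natural D)=(\mathcal{O}_X(-D)\cdot\mathcal{O}_Y)^{\vee\vee}$. The pullback is $f^*D:=\sum_{E\subset Y}\mathrm{val}_E(D)E$, where $\mathrm{val}_E(D):=\lim_{k\to\infty}\mathrm{val}_E(\mathcal{O}_X(-k!D))/k!$ (the limit exists). Canonical divisors are always chosen so that $f_*K_Y=K_X$. Define $K^-_{m,Y/X}:=K_Y-\frac1m f^\natural(mK_X)$ and $K^+_{Y/X}:=K_Y+f^*(-K_X)$. For a prime divisor $F$ on $Y$ put $a_m(F,X):=\mathrm{ord}_F(K^-_{m,Y/X})$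 and $a^+(F,X):=\mathrm{ord}_F(K^+_{Y/X})$. $X$ has log terminal${}^+$ (lt${}^+$) singularities if $a^+(F,X)>-1$ for all prime divisors $F$ exceptional over $X$. $X$ is klt, or log terminal (in the sense of de Fernex–Hacon), if there is an integer $m_0\ge1$ such that $a_{m_0}(F,X)>-1$ for every prime divisor $F$ exceptional over $X$; equivalently, there is an effective $\mathbb{Q}$-divisor $\Delta$ with $K_X+\Delta$ $\mathbb{Q}$-Cartier and $(X,\Delta)$ Kawamata log terminal. Defect ideals. A log resolution of $X$ is a proper birational morphism from a smooth variety whose exceptional locus is a simple normal crossing divisor. For a divisor $D$ on $X$ and $m\ge1$, let $f_m:Y_m\to X$ be a log resolution of $(X,\mathcal{O}_X(mD)\otimes\mathcal{O}_X(-mD))$, i.e. a log resolution such that $\mathcal{O}_X(mD)\cdot\mathcal{O}_{Y_m}$ and $\mathcal{O}_X(-mD)\cdot\mathcal{O}_{Y_m}$ are invertible. The $m$-th defect ideal is $$\mathfrak{d}^m(D):=f_{m,*}\mathcal{O}_{Y_m}\Big(\Big\lfloor\tfrac1m\big(-f_m^\natural(-mD)-f_m^\natural(mD)\big)\Big\rfloor\Big)\subseteq\mathcal{O}_X .$$ When $\mathscr{R}(X,D)$ is finitely generated (which holds for $D=K_X$ if $X$ is lt${}^+$), $\mathfrak{D}(D):=\limsup_{m\to\infty}\mathfrak{d}^m(D)$ denotes the stable value of these ideals: the ideal sheaf with $\mathfrak{d}^m(D)=\mathfrak{D}(D)$ for all sufficiently divisible $m$. *)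

theory Defs
  imports
    "HOL-Algebra.Ideal"
    "HOL-Algebra.Generated_Rings"
    "HOL-Analysis.Abstract_Topology"
    "HOL-Combinatorics.Permutations"
    "HOL-Computational_Algebra.Polynomial"
    "HOL-Library.Extended_Nat"
    Complex_Main
begin

text \<open>
  An integral separated scheme of finite type over the complex numbers is determined by its
  function field and the set of its local rings inside that field (the models of Zariski, the
  schemata of Chevalley; see Zariski--Samuel VI.17, EGA I.8). We work in this language: the function
  field is the type \<open>'a\<close>, made into an extension of the complex numbers by a ring homomorphism
  \<open>\<iota>\<close>; a point of a variety is its local ring, a subset of \<open>'a\<close>; a variety is the
  set of all its points, closed or not; the generic point is \<open>UNIV\<close>. A birational morphism
  identifies the two function fields, so both varieties are sets of subrings of the same \<open>'a\<close>.
  All sheaves that occur are subsheaves of the constant sheaf \<open>'a\<close>; a sheaf is the function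
  sending an open set to its set of sections.
\<close>

type_synonym 'a point = "'a set"
type_synonym 'a model = "'a point set"
type_synonym 'a fsheaf = "'a point set \<Rightarrow> 'a set"

section \<open>Local rings in a field\<close>

definition ring_on :: "'a::field set \<Rightarrow> 'a ring" where
  "ring_on A = \<lparr>carrier = A, monoid.mult = (*), one = 1, ring.zero = 0, add = (+)\<rparr>"

definition max_ideal :: "'a::field set \<Rightarrow> 'a set" where
  "max_ideal R = R - Units (ring_on R)"

definition local_subring :: "'a::field set \<Rightarrow> bool" where
  "local_subring R \<longleftrightarrow> subring R (ring_on UNIV) \<and> ideal (max_ideal R) (ring_on R)"

definition dominates :: "'a::field set \<Rightarrow> 'a set \<Rightarrow> bool" where
  "dominates R S \<longleftrightarrow> S \<subseteq> R \<and> max_ideal R \<inter> S = max_ideal S"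

definition valuation_subring :: "'a::field set \<Rightarrow> bool" where
  "valuation_subring V \<longleftrightarrow>
     subring V (ring_on UNIV) \<and> (\<forall>\<phi>. \<phi> \<in> V \<or> inverse \<phi> \<in> V)"

definition integrally_closed :: "'a::field set \<Rightarrow> bool" where
  "integrally_closed R \<longleftrightarrow>
     (\<forall>\<phi> p. lead_coeff p = 1 \<and> (\<forall>i. Polynomial.coeff p i \<in> R) \<and> poly p \<phi> = 0 \<longrightarrow> \<phi> \<in> R)"

definition span_over :: "'a::field set \<Rightarrow> 'a set \<Rightarrow> 'a set" where
  "span_over R S = {(\<Sum>i<n. a i * s i) | (n::nat) a s. \<forall>i<n. a i \<in> R \<and> s i \<in> S}"

definition krull_dim :: "'a::field set \<Rightarrow> enat" where
  "krull_dim R =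
     (SUP n \<in> {n. \<exists>P. (\<forall>i\<le>n. primeideal (P i) (ring_on R)) \<and> (\<forall>i<n. P i \<subset> P (Suc i))}. enat n)"

definition regular_parameters :: "'a::field set \<Rightarrow> 'a list \<Rightarrow> bool" where
  "regular_parameters R ts \<longleftrightarrow>
     max_ideal R = span_over R (set ts) \<and> enat (length ts) = krull_dim R"

text \<open>
  The normalised valuation of a discrete valuation ring \<open>R\<close>, at a nonzero element; the value
  at \<open>0\<close>, which should be infinite, is never used.
\<close>
definition val :: "'a::field set \<Rightarrow> 'a \<Rightarrow> int" where
  "val R \<phi> = (THE k. \<exists>t u. max_ideal R = (\<lambda>a. t * a) ` R \<and> u \<in> Units (ring_on R) \<and> \<phi> = u * t powi k)"

section \<open>Varieties and birational morphisms\<close>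

definition affine_algebra :: "(complex \<Rightarrow> 'a::field) \<Rightarrow> 'a set \<Rightarrow> bool" where
  "affine_algebra \<iota> A \<longleftrightarrow>
     (\<exists>S. finite S \<and> A = generate_ring (ring_on UNIV) (range \<iota> \<union> S)) \<and>
     (\<forall>\<phi>. \<exists>a\<in>A. \<exists>b\<in>A. b \<noteq> 0 \<and> \<phi> = a / b)"

definition Spec_model :: "'a::field set \<Rightarrow> 'a model" where
  "Spec_model A = {{a / b | a b. a \<in> A \<and> b \<in> A - P} | P. primeideal P (ring_on A)}"

text \<open>
  The last condition is separatedness: distinct points are not dominated by a common local ring.
\<close>
definition variety :: "(complex \<Rightarrow> 'a::field) \<Rightarrow> 'a model \<Rightarrow> bool" where
  "variety \<iota> X \<longleftrightarrow>
     \<iota> \<in> ring_hom (ring_on UNIV) (ring_on UNIV) \<and>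
     (\<exists>\<A>. finite \<A> \<and> \<A> \<noteq> {} \<and> (\<forall>A\<in>\<A>. affine_algebra \<iota> A) \<and> X = (\<Union>A\<in>\<A>. Spec_model A)) \<and>
     (\<forall>x\<in>X. \<forall>x'\<in>X. \<forall>R. local_subring R \<and> dominates R x \<and> dominates R x' \<longrightarrow> x = x')"

definition normal_variety :: "(complex \<Rightarrow> 'a::field) \<Rightarrow> 'a model \<Rightarrow> bool" where
  "normal_variety \<iota> X \<longleftrightarrow> variety \<iota> X \<and> (\<forall>x\<in>X. integrally_closed x)"

text \<open>
  On an affine model \<open>Spec_model A\<close> the principal open set of a nonzero \<open>f \<in> A\<close> is the
  set of points at which \<open>1 / f\<close> is regular. Conversely domains of definition are open.
\<close>
definition zariski :: "'a::field model \<Rightarrow> 'a point topology" where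
  "zariski X = topology_generated_by {{x \<in> X. \<phi> \<in> x} | \<phi>. True}"

definition dimension :: "'a::field model \<Rightarrow> enat" where
  "dimension X = (SUP x\<in>X. krull_dim x)"

text \<open>
  The point of \<open>X\<close> dominated by a local ring \<open>R\<close>. For a point \<open>R\<close> of a variety
  \<open>Y\<close> over \<open>X\<close> this is the image of that point; for the ring of a valuation it is
  the generic point of the center.
\<close>
definition center_pt :: "'a::field model \<Rightarrow> 'a set \<Rightarrow> 'a point" where
  "center_pt X R = (THE x. x \<in> X \<and> dominates R x)"

definition center :: "'a::field model \<Rightarrow> 'a set \<Rightarrow> 'a point set" where
  "center X R = zariski X closure_of {center_pt X R}"

text \<open>
  The identity of the function field induces a morphism from \<open>Y\<close> to \<open>X\<close> iff every point
  of \<open>Y\<close> dominates a point of \<open>X\<close>; properness is the valuative criterion, for which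
  valuation rings of the function field suffice.
\<close>
definition proper_birational :: "'a::field model \<Rightarrow> 'a model \<Rightarrow> bool" where
  "proper_birational Y X \<longleftrightarrow>
     (\<forall>y\<in>Y. \<exists>x\<in>X. dominates y x) \<and>
     (\<forall>V. valuation_subring V \<and> (\<exists>x\<in>X. dominates V x) \<longrightarrow> (\<exists>y\<in>Y. dominates V y))"

section \<open>Divisors and divisorial sheaves\<close>

text \<open>
  A prime divisor is represented by its generic point, a point of codimension one. Note that
  inclusion of local rings is generalisation of points. A Weil divisor is the function giving its
  coefficients, zero off the prime divisors.
\<close>
definition prime_divisor :: "'a::field model \<Rightarrow> 'a point \<Rightarrow> bool" where
  "prime_divisor X E \<longleftrightarrow> E \<in> X \<and> E \<noteq> UNIV \<and> (\<forall>x\<in>X. E \<subseteq> x \<longrightarrow> x = E \<or> x = UNIV)"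

definition exceptional_divisor :: "'a::field model \<Rightarrow> 'a model \<Rightarrow> 'a point \<Rightarrow> bool" where
  "exceptional_divisor Y X E \<longleftrightarrow> prime_divisor Y E \<and> \<not> prime_divisor X (center_pt X E)"

definition structure_sheaf :: "'a::field fsheaf" where
  "structure_sheaf U = \<Inter>U"

definition div_sheaf :: "'a::field model \<Rightarrow> ('a point \<Rightarrow> int) \<Rightarrow> 'a fsheaf" where
  "div_sheaf X D U = {\<phi>. \<phi> = 0 \<or> (\<forall>E\<in>U. prime_divisor X E \<longrightarrow> 0 \<le> val E \<phi> + D E)}"

definition stalk :: "'a::field model \<Rightarrow> 'a fsheaf \<Rightarrow> 'a point \<Rightarrow> 'a set" where
  "stalk X \<F> x = (\<Union>U \<in> {U. openin (zariski X) U \<and> x \<in> U}. \<F> U)"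

text \<open>Sections over the empty set are disregarded.\<close>
definition sheaf_eq :: "'a::field model \<Rightarrow> 'a fsheaf \<Rightarrow> 'a fsheaf \<Rightarrow> bool" where
  "sheaf_eq X \<F> \<G> \<longleftrightarrow> (\<forall>U. openin (zariski X) U \<and> U \<noteq> {} \<longrightarrow> \<F> U = \<G> U)"

definition sheaf_pushforward :: "'a::field model \<Rightarrow> 'a model \<Rightarrow> 'a fsheaf \<Rightarrow> 'a fsheaf" where
  "sheaf_pushforward Y X \<F> U = \<F> {y \<in> Y. center_pt X y \<in> U}"

text \<open>The stalk at \<open>y\<close> of the fractional ideal sheaf generated on \<open>Y\<close> by one on \<open>X\<close>.\<close>
definition inverse_image_stalk :: "'a::field model \<Rightarrow> 'a fsheaf \<Rightarrow> 'a point \<Rightarrow> 'a set" where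
  "inverse_image_stalk X \<F> y = span_over y (stalk X \<F> (center_pt X y))"

definition inverse_image_invertible :: "'a::field model \<Rightarrow> 'a model \<Rightarrow> 'a fsheaf \<Rightarrow> bool" where
  "inverse_image_invertible Y X \<F> \<longleftrightarrow>
     (\<forall>y\<in>Y. \<exists>V g. openin (zariski Y) V \<and> y \<in> V \<and> g \<noteq> 0 \<and>
        (\<forall>z\<in>V. inverse_image_stalk X \<F> z = (\<lambda>a. g * a) ` z))"

text \<open>
  The cycle-theoretic pushforward along a proper birational morphism from \<open>Y\<close> to \<open>X\<close>:
  a prime divisor of \<open>X\<close> and its strict transform have the same local ring, and all other
  prime divisors of \<open>Y\<close> are exceptional.
\<close>
definition div_pushforward :: "'a::field model \<Rightarrow> ('a point \<Rightarrow> int) \<Rightarrow> 'a point \<Rightarrow> int" where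
  "div_pushforward X D E = (if prime_divisor X E then D E else 0)"

section \<open>Pullbacks of Weil divisors\<close>

definition val_ideal :: "'a::field model \<Rightarrow> 'a set \<Rightarrow> 'a fsheaf \<Rightarrow> int" where
  "val_ideal X E \<I> =
     (LEAST k. \<exists>U \<phi>. openin (zariski X) U \<and> U \<inter> center X E \<noteq> {} \<and> \<phi> \<in> \<I> U \<and> \<phi> \<noteq> 0 \<and> k = val E \<phi>)"

definition nat_pullback :: "'a::field model \<Rightarrow> ('a point \<Rightarrow> int) \<Rightarrow> 'a point \<Rightarrow> int" where
  "nat_pullback X D E = val_ideal X E (div_sheaf X (\<lambda>x. - D x))"

definition pullback :: "'a::field model \<Rightarrow> ('a point \<Rightarrow> int) \<Rightarrow> 'a point \<Rightarrow> real" where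
  "pullback X D E = lim (\<lambda>k. of_int (val_ideal X E (div_sheaf X (\<lambda>x. - (int (fact k) * D x)))) / fact k)"

section \<open>Canonical divisors\<close>

definition derivation :: "(complex \<Rightarrow> 'a::field) \<Rightarrow> ('a \<Rightarrow> 'a) \<Rightarrow> bool" where
  "derivation \<iota> \<delta> \<longleftrightarrow>
     (\<forall>a b. \<delta> (a + b) = \<delta> a + \<delta> b) \<and> (\<forall>a b. \<delta> (a * b) = a * \<delta> b + b * \<delta> a) \<and> (\<forall>c. \<delta> (\<iota> c) = 0)"

text \<open>
  The Kaehler differentials of the function field are a finite dimensional vector space dual to its
  derivations over the complex numbers, so a rational \<open>n\<close>-form is realised as an alternating
  function of \<open>n\<close> derivations: \<open>dwedge\<close> is \<open>d x\<^sub>0 \<and> \<dots> \<and> d x\<^sub>n\<^sub>-\<^sub>1\<close>.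
  The module \<open>forms \<iota> n R\<close> is the image in there of the \<open>n\<close>-th exterior power of the
  Kaehler differentials of \<open>R\<close>.
\<close>
definition dwedge ::
  "(complex \<Rightarrow> 'a::field) \<Rightarrow> nat \<Rightarrow> (nat \<Rightarrow> 'a) \<Rightarrow> (nat \<Rightarrow> 'a \<Rightarrow> 'a) \<Rightarrow> 'a" where
  "dwedge \<iota> n x \<delta> =
     (if \<forall>i<n. derivation \<iota> (\<delta> i)
      then \<Sum>p | p permutes {..<n}. of_int (sign p) * (\<Prod>i<n. \<delta> i (x (p i)))
      else 0)"

definition forms ::
  "(complex \<Rightarrow> 'a::field) \<Rightarrow> nat \<Rightarrow> 'a set \<Rightarrow> ((nat \<Rightarrow> 'a \<Rightarrow> 'a) \<Rightarrow> 'a) set" where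
  "forms \<iota> n R =
     {\<lambda>\<delta>. \<Sum>j<N. a j * dwedge \<iota> n (x j) \<delta> | (N::nat) a x.
        \<forall>j<N. a j \<in> R \<and> (\<forall>i<n. x j i \<in> R)}"

text \<open>
  The forms regular at the generic point of \<open>E\<close> are a free module of rank one over the
  discrete valuation ring \<open>E\<close> if \<open>n\<close> is the dimension.
\<close>
definition form_ord ::
  "(complex \<Rightarrow> 'a::field) \<Rightarrow> nat \<Rightarrow> 'a set \<Rightarrow> ((nat \<Rightarrow> 'a \<Rightarrow> 'a) \<Rightarrow> 'a) \<Rightarrow> int" where
  "form_ord \<iota> n E \<omega> =
     (THE k. \<forall>\<phi>. (\<lambda>\<delta>. \<phi> * \<omega> \<delta>) \<in> forms \<iota> n E \<longleftrightarrow> \<phi> = 0 \<or> 0 \<le> val E \<phi> + k)"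

definition canonical_divisor ::
  "(complex \<Rightarrow> 'a::field) \<Rightarrow> 'a model \<Rightarrow> ('a point \<Rightarrow> int) \<Rightarrow> bool" where
  "canonical_divisor \<iota> X K \<longleftrightarrow>
     (\<exists>n \<omega>. enat n = dimension X \<and> \<omega> \<in> forms \<iota> n UNIV \<and> \<omega> \<noteq> (\<lambda>_. 0) \<and>
        K = (\<lambda>E. if prime_divisor X E then form_ord \<iota> n E \<omega> else 0))"

section \<open>Singularities\<close>

text \<open>
  Throughout, \<open>KX\<close> is a canonical divisor of \<open>X\<close>, and \<open>KY\<close> is the canonical divisor of
  \<open>Y\<close> with pushforward \<open>KX\<close>. Replacing \<open>KX\<close> by a linearly equivalent divisor changes
  neither the discrepancies nor the defect ideals.
\<close>

definition K_minus ::
  "'a::field model \<Rightarrow> nat \<Rightarrow> ('a point \<Rightarrow> int) \<Rightarrow> ('a point \<Rightarrow> int) \<Rightarrow> 'a point \<Rightarrow> real" where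
  "K_minus X m KX KY F = of_int (KY F) - of_int (nat_pullback X (\<lambda>x. int m * KX x) F) / of_nat m"

definition K_plus ::
  "'a::field model \<Rightarrow> ('a point \<Rightarrow> int) \<Rightarrow> ('a point \<Rightarrow> int) \<Rightarrow> 'a point \<Rightarrow> real" where
  "K_plus X KX KY F = of_int (KY F) + pullback X (\<lambda>x. - KX x) F"

definition lt_plus ::
  "(complex \<Rightarrow> 'a::field) \<Rightarrow> 'a model \<Rightarrow> ('a point \<Rightarrow> int) \<Rightarrow> bool" where
  "lt_plus \<iota> X KX \<longleftrightarrow>
     (\<forall>Y KY F. normal_variety \<iota> Y \<and> proper_birational Y X \<and>
        canonical_divisor \<iota> Y KY \<and> div_pushforward X KY = KX \<and> exceptional_divisor Y X F
        \<longrightarrow> K_plus X KX KY F > -1)"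

definition klt ::
  "(complex \<Rightarrow> 'a::field) \<Rightarrow> 'a model \<Rightarrow> ('a point \<Rightarrow> int) \<Rightarrow> bool" where
  "klt \<iota> X KX \<longleftrightarrow>
     (\<exists>m\<ge>1. \<forall>Y KY F. normal_variety \<iota> Y \<and> proper_birational Y X \<and>
        canonical_divisor \<iota> Y KY \<and> div_pushforward X KY = KX \<and> exceptional_divisor Y X F
        \<longrightarrow> K_minus X m KX KY F > -1)"

section \<open>Defect ideals\<close>

text \<open>Over the complex numbers, smooth means that all local rings are regular.\<close>
definition smooth :: "'a::field model \<Rightarrow> bool" where
  "smooth Y \<longleftrightarrow> (\<forall>y\<in>Y. \<exists>ts. regular_parameters y ts)"

text \<open>The morphism is a local isomorphism at \<open>y\<close> iff \<open>y\<close> and its image have the same local ring.\<close>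
definition exceptional_locus :: "'a::field model \<Rightarrow> 'a model \<Rightarrow> 'a point set" where
  "exceptional_locus Y X = {y \<in> Y. center_pt X y \<noteq> y}"

text \<open>
  Near every point the set is the zero locus of a product of distinct members of a regular system
  of parameters; the points \<open>z\<close> with \<open>y \<subseteq> z\<close> are those of the spectrum of the local ring
  \<open>y\<close>.
\<close>
definition snc_divisor :: "'a::field model \<Rightarrow> 'a point set \<Rightarrow> bool" where
  "snc_divisor Y Z \<longleftrightarrow>
     (\<forall>y\<in>Y. \<exists>ts s. regular_parameters y ts \<and> s \<le> length ts \<and>
        {z \<in> Z. y \<subseteq> z} = {z \<in> Y. y \<subseteq> z \<and> (\<exists>i<s. ts ! i \<in> max_ideal z)})"

definition log_resolution :: "(complex \<Rightarrow> 'a::field) \<Rightarrow> 'a model \<Rightarrow> 'a model \<Rightarrow> bool" where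
  "log_resolution \<iota> Y X \<longleftrightarrow>
     normal_variety \<iota> Y \<and> smooth Y \<and> proper_birational Y X \<and> snc_divisor Y (exceptional_locus Y X)"

text \<open>
  The defect ideal does not depend on the log resolution, whence the relational form: \<open>\<J>\<close> is
  the \<open>m\<close>-th defect ideal of \<open>D\<close> if it is computed by some log resolution.
\<close>
definition is_defect_ideal ::
  "(complex \<Rightarrow> 'a::field) \<Rightarrow> 'a model \<Rightarrow> nat \<Rightarrow> ('a point \<Rightarrow> int) \<Rightarrow> 'a fsheaf \<Rightarrow> bool" where
  "is_defect_ideal \<iota> X m D \<J> \<longleftrightarrow>
     (\<exists>Y. log_resolution \<iota> Y X \<and>
        inverse_image_invertible Y X (div_sheaf X (\<lambda>x. int m * D x)) \<and>
        inverse_image_invertible Y X (div_sheaf X (\<lambda>x. - (int m * D x))) \<and>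
        sheaf_eq X \<J> (sheaf_pushforward Y X (div_sheaf Y (\<lambda>E.
          \<lfloor>of_int (- nat_pullback X (\<lambda>x. - (int m * D x)) E - nat_pullback X (\<lambda>x. int m * D x) E)
             / real m\<rfloor>))))"

text \<open>
  \<open>\<J>\<close> is the common value of the defect ideals of all sufficiently divisible orders. The
  existence of this value is part of the assertion.
\<close>
definition is_stable_defect_ideal ::
  "(complex \<Rightarrow> 'a::field) \<Rightarrow> 'a model \<Rightarrow> ('a point \<Rightarrow> int) \<Rightarrow> 'a fsheaf \<Rightarrow> bool" where
  "is_stable_defect_ideal \<iota> X D \<J> \<longleftrightarrow>
     (\<exists>m\<^sub>0\<ge>1. \<forall>m\<ge>1. m\<^sub>0 dvd m \<longrightarrow> is_defect_ideal \<iota> X m D \<J>)"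

end

theory Submission
  imports Defs
begin

text \<open>
  Put \<open>K = K\<^sub>X\<close> and choose \<open>m\<close> with \<open>\<dd>\<^sup>m(K) = \<O>\<^sub>X\<close>. On a log resolution computing this ideal the
  sheaves generated by \<open>\<O>\<^sub>X(m K)\<close> and \<open>\<O>\<^sub>X(- m K)\<close> have local generators \<open>g\<close> and \<open>h\<close>, and
  \<open>1 \<in> \<dd>\<^sup>m(K)\<close> says that \<open>1 / (g h)\<close> is regular in codimension one, hence regular by normality.
  So the values of \<open>\<O>\<^sub>X(m K)\<close> and \<open>\<O>\<^sub>X(- m K)\<close> at every divisor \<open>F\<close> over \<open>X\<close> add up to \<open>0\<close>.
  Since values are subadditive and opposite divisors have values with nonnegative sum, the value of
  \<open>\<O>\<^sub>X(j m K)\<close> is then exactly \<open>j\<close> times that of \<open>\<O>\<^sub>X(m K)\<close>; the limit defining the pullback is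
  eventually constant, and \<open>a\<^sub>m(F, X) = a\<^sup>+(F, X)\<close>. Normality enters through the fact that a point
  of a normal variety is the intersection of the discrete valuation rings of the prime divisors
  through it, which rests on Hilbert's basis theorem.
\<close>

section \<open>Noetherian subrings\<close>

text \<open>The locale lives over commutative rings rather than fields because Hilbert's basis
  theorem needs it for sets of polynomials. For subsets of a field,
  \<open>subring_ring_on_iff\<close> identifies it with the subrings of the definitions.\<close>

locale unital_subring =
  fixes R :: "'a::comm_ring_1 set"
  assumes zero_closed [simp]: "0 \<in> R"
    and one_closed [simp]: "1 \<in> R"
    and uminus_closed [simp]: "a \<in> R \<Longrightarrow> - a \<in> R"
    and add_closed [simp]: "a \<in> R \<Longrightarrow> b \<in> R \<Longrightarrow> a + b \<in> R"
    and mult_closed [simp]: "a \<in> R \<Longrightarrow> b \<in> R \<Longrightarrow> a * b \<in> R"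
begin

lemma power_closed [simp]: "a \<in> R \<Longrightarrow> a ^ n \<in> R"
  by (induction n) auto

lemma sum_closed: "(\<And>i. i \<in> I \<Longrightarrow> f i \<in> R) \<Longrightarrow> sum f I \<in> R"
  by (induction I rule: infinite_finite_induct) auto

end

text \<open>Closure under negation comes from multiplication by \<open>- 1\<close> when
  \<open>R\<close> is a unital subring.\<close>

definition ideal_in :: "'a::comm_ring_1 set \<Rightarrow> 'a set \<Rightarrow> bool" where
  "ideal_in I R \<longleftrightarrow> I \<subseteq> R \<and> 0 \<in> I \<and> (\<forall>a\<in>I. \<forall>b\<in>I. a + b \<in> I) \<and> (\<forall>a\<in>R. \<forall>b\<in>I. a * b \<in> I)"

lemma ideal_in_sum:
  "ideal_in I R \<Longrightarrow> (\<And>k. k \<in> S \<Longrightarrow> f k \<in> I) \<Longrightarrow> sum f S \<in> I"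
  by (induction S rule: infinite_finite_induct) (auto simp: ideal_in_def)

definition lin_span :: "'a::comm_ring_1 set \<Rightarrow> (nat \<Rightarrow> 'a) \<Rightarrow> nat \<Rightarrow> 'a set" where
  "lin_span R s n = {\<Sum>i<n. a i * s i | a. \<forall>i<n. a i \<in> R}"

lemma lin_spanI: "x = (\<Sum>i<n. a i * s i) \<Longrightarrow> (\<And>i. i < n \<Longrightarrow> a i \<in> R) \<Longrightarrow> x \<in> lin_span R s n"
  unfolding lin_span_def by blast

text \<open>
  The chain condition is stated for the ideals generated by the initial segments of a sequence. In
  this form it passes to images and to localisations immediately, and for the sequence of powers of
  an element it is an equation of integral dependence.
\<close>
definition noetherian :: "'a::comm_ring_1 set \<Rightarrow> bool" where
  "noetherian R \<longleftrightarrow> (\<forall>s. (\<forall>i. s i \<in> R) \<longrightarrow> (\<exists>n. s n \<in> lin_span R s n))"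

lemma noetherianE:
  assumes "noetherian R" "\<And>i. s i \<in> R"
  obtains n where "s n \<in> lin_span R s n"
  using assms by (auto simp: noetherian_def)

lemma lin_span_least:
  assumes "ideal_in J R" "\<And>i. i < n \<Longrightarrow> s i \<in> J"
  shows "lin_span R s n \<subseteq> J"
proof
  fix x assume "x \<in> lin_span R s n"
  then obtain a where "x = (\<Sum>i<n. a i * s i)" "\<forall>i<n. a i \<in> R"
    by (auto simp: lin_span_def)
  then show "x \<in> J"
    using assms by (auto intro!: ideal_in_sum[OF assms(1)] simp: ideal_in_def)
qed

lemma lin_span_cong:
  assumes "\<And>i. i < n \<Longrightarrow> s i = t i"
  shows "lin_span R s n = lin_span R t n"
proof -
  have "(\<Sum>i<n. a i * s i) = (\<Sum>i<n. a i * t i)" for a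
    using assms by (intro sum.cong) auto
  then show ?thesis by (simp add: lin_span_def)
qed

context unital_subring
begin

lemma ideal_in_lin_span:
  assumes "\<And>i. i < n \<Longrightarrow> s i \<in> R"
  shows "ideal_in (lin_span R s n) R"
  unfolding ideal_in_def
proof (intro conjI ballI)
  show "lin_span R s n \<subseteq> R"
    using assms by (auto simp: lin_span_def intro!: sum_closed)
  show "0 \<in> lin_span R s n"
    by (rule lin_spanI[where a = "\<lambda>i. 0"]) simp_all
next
  fix x y assume "x \<in> lin_span R s n" "y \<in> lin_span R s n"
  then obtain a b where "x = (\<Sum>i<n. a i * s i)" "\<forall>i<n. a i \<in> R"
      "y = (\<Sum>i<n. b i * s i)" "\<forall>i<n. b i \<in> R"
    by (auto simp: lin_span_def)
  then show "x + y \<in> lin_span R s n"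
    by (intro lin_spanI[where a = "\<lambda>i. a i + b i"]) (simp_all add: sum.distrib distrib_right)
next
  fix r y assume "r \<in> R" "y \<in> lin_span R s n"
  then obtain b where "y = (\<Sum>i<n. b i * s i)" "\<forall>i<n. b i \<in> R"
    by (auto simp: lin_span_def)
  then show "r * y \<in> lin_span R s n"
    using \<open>r \<in> R\<close> by (intro lin_spanI[where a = "\<lambda>i. r * b i"])
      (simp_all add: sum_distrib_left mult.assoc)
qed

lemma lin_span_superset:
  assumes "i < n"
  shows "s i \<in> lin_span R s n"
proof -
  have "(\<Sum>k<n. (if k = i then 1 else 0) * s k) = (\<Sum>k<n. if k = i then s k else 0)"
    by (intro sum.cong) auto
  then show ?thesis
    using assms by (intro lin_spanI[where a = "\<lambda>k. if k = i then 1 else 0"]) simp_all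
qed

lemma lin_span_mono:
  assumes "\<And>i. i < n \<Longrightarrow> s i \<in> R" "m \<le> n"
  shows "lin_span R s m \<subseteq> lin_span R s n"
  using assms by (intro lin_span_least ideal_in_lin_span lin_span_superset) auto

lemma ideal_in_Union_lin_span:
  assumes "\<And>i. s i \<in> R"
  shows "ideal_in (\<Union>n. lin_span R s n) R"
  unfolding ideal_in_def
proof (intro conjI ballI)
  have id: "ideal_in (lin_span R s n) R" for n
    using assms by (intro ideal_in_lin_span)
  show "(\<Union>n. lin_span R s n) \<subseteq> R" "0 \<in> (\<Union>n. lin_span R s n)"
    using id unfolding ideal_in_def by blast+
  show "r * y \<in> (\<Union>n. lin_span R s n)" if "r \<in> R" "y \<in> (\<Union>n. lin_span R s n)" for r y
    using id that unfolding ideal_in_def by blast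
  show "x + y \<in> (\<Union>n. lin_span R s n)"
    if xy: "x \<in> (\<Union>n. lin_span R s n)" "y \<in> (\<Union>n. lin_span R s n)" for x y
  proof -
    obtain m n where "x \<in> lin_span R s m" "y \<in> lin_span R s n" using xy by blast
    then have "x \<in> lin_span R s (max m n)" "y \<in> lin_span R s (max m n)"
      using assms lin_span_mono[of "max m n" s m] lin_span_mono[of "max m n" s n] by auto
    then show ?thesis using id[of "max m n"] by (auto simp: ideal_in_def)
  qed
qed

end

text \<open>Without a maximal member, dependent choice gives a strictly increasing sequence
  \<open>f\<close> of ideals. An element \<open>s n\<close> of \<open>f (Suc n)\<close> outside
  \<open>f n\<close> cannot be a combination of its predecessors, which all lie in
  \<open>f n\<close>.\<close>

lemma noetherian_maximal_ideal:
  assumes R: "noetherian R" "unital_subring R"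
    and \<F>: "\<F> \<noteq> {}" "\<And>I. I \<in> \<F> \<Longrightarrow> ideal_in I R"
  obtains M where "M \<in> \<F>" "\<And>I. I \<in> \<F> \<Longrightarrow> M \<subseteq> I \<Longrightarrow> I = M"
proof (rule ccontr)
  interpret unital_subring R by fact
  assume "\<not> thesis"
  then have "\<forall>M\<in>\<F>. \<exists>I\<in>\<F>. M \<subset> I" using that by blast
  then have "\<exists>f. \<forall>n. f n \<in> \<F> \<and> f n \<subset> f (Suc n)"
    using \<F>(1) by (intro dependent_nat_choice) auto
  then obtain f where f: "\<And>n. f n \<in> \<F>" "\<And>n. f n \<subset> f (Suc n)" by blast
  have "\<forall>n. \<exists>x. x \<in> f (Suc n) - f n" using f by blast
  then obtain s where s: "\<And>n. s n \<in> f (Suc n)" "\<And>n. s n \<notin> f n" by (metis DiffE)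
  have mono: "f m \<subseteq> f n" if "m \<le> n" for m n
    using lift_Suc_mono_le[of f, OF _ that] f by blast
  have "\<forall>i. s i \<in> R" using s f \<F>(2) by (meson ideal_in_def subsetD)
  then obtain n where n: "s n \<in> lin_span R s n" using R by (auto simp: noetherian_def)
  have "lin_span R s n \<subseteq> f n"
  proof (rule lin_span_least)
    show "ideal_in (f n) R" using f \<F> by auto
    show "s i \<in> f n" if "i < n" for i using s(1)[of i] mono[of "Suc i" n] that by auto
  qed
  then show False using n s by auto
qed

section \<open>Polynomial rings and Hilbert's basis theorem\<close>

definition polys_over :: "'a::comm_ring_1 set \<Rightarrow> 'a poly set" where
  "polys_over R = {p. \<forall>i. Polynomial.coeff p i \<in> R}"

lemma unital_subring_polys_over:
  assumes "unital_subring R"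
  shows "unital_subring (polys_over R)"
proof -
  interpret unital_subring R by fact
  show ?thesis
    by unfold_locales (auto simp: polys_over_def coeff_mult intro!: sum_closed)
qed

text \<open>
  Hilbert's basis theorem. In an ideal that is not finitely generated one can choose elements of
  minimal degree outside the ideal generated by the earlier ones; a relation between their leading
  coefficients then yields an element of smaller degree.
\<close>
theorem noetherian_polys_over:
  assumes noeth: "noetherian R" and sub: "unital_subring R"
  shows "noetherian (polys_over R)"
  unfolding noetherian_def
proof (intro allI impI, rule ccontr)
  interpret R: unital_subring R by fact
  interpret P: unital_subring "polys_over R" using sub by (rule unital_subring_polys_over)
  let ?P = "polys_over R"
  fix s :: "nat \<Rightarrow> 'a poly"
  assume s: "\<forall>i. s i \<in> ?P" and bad: "\<nexists>n. s n \<in> lin_span ?P s n"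
  define I where "I = (\<Union>n. lin_span ?P s n)"
  have idI: "ideal_in I ?P"
    unfolding I_def using s by (intro P.ideal_in_Union_lin_span) auto
  have "\<exists>f. \<forall>k::nat. f k \<in> I \<and> f k \<notin> lin_span ?P f k \<and>
      (\<forall>q\<in>I. q \<notin> lin_span ?P f k \<longrightarrow> Polynomial.degree (f k) \<le> Polynomial.degree q)"
  proof (rule dependent_wellorder_choice)
    fix r and f g :: "nat \<Rightarrow> 'a poly" and k :: nat
    assume "\<And>j. j < k \<Longrightarrow> f j = g j"
    then have "lin_span ?P f k = lin_span ?P g k" by (rule lin_span_cong)
    then show "(r \<in> I \<and> r \<notin> lin_span ?P f k \<and>
        (\<forall>q\<in>I. q \<notin> lin_span ?P f k \<longrightarrow> Polynomial.degree r \<le> Polynomial.degree q)) =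
      (r \<in> I \<and> r \<notin> lin_span ?P g k \<and>
        (\<forall>q\<in>I. q \<notin> lin_span ?P g k \<longrightarrow> Polynomial.degree r \<le> Polynomial.degree q))" by simp
  next
    fix k :: nat and f :: "nat \<Rightarrow> 'a poly"
    assume IH: "\<And>j. j < k \<Longrightarrow> f j \<in> I \<and> f j \<notin> lin_span ?P f j \<and>
      (\<forall>q\<in>I. q \<notin> lin_span ?P f j \<longrightarrow> Polynomial.degree (f j) \<le> Polynomial.degree q)"
    then have "\<forall>j<k. \<exists>n. f j \<in> lin_span ?P s n" by (auto simp: I_def)
    then obtain N where N: "\<And>j. j < k \<Longrightarrow> f j \<in> lin_span ?P s (N j)" by metis
    \<comment> \<open>The earlier \<open>f j\<close> involve only finitely many terms of
      \<open>s\<close>, so one \<open>M\<close> bounds them all. By \<open>bad\<close>, the term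
      \<open>s M\<close> is then outside the ideal that they generate.\<close>
    define M where "M = Max (insert 0 (N ` {..<k}))"
    have "f j \<in> lin_span ?P s M" if "j < k" for j
    proof -
      have "N j \<le> M" using that by (auto simp: M_def intro!: Max_ge)
      then show ?thesis using N[OF that] P.lin_span_mono[of M s "N j"] s by blast
    qed
    then have "lin_span ?P f k \<subseteq> lin_span ?P s M"
      using s by (intro lin_span_least P.ideal_in_lin_span) auto
    then have "s M \<notin> lin_span ?P f k" using bad by blast
    moreover have "s M \<in> I"
      unfolding I_def using P.lin_span_superset[of M "Suc M" s] by blast
    ultimately show "\<exists>r. r \<in> I \<and> r \<notin> lin_span ?P f k \<and>
        (\<forall>q\<in>I. q \<notin> lin_span ?P f k \<longrightarrow> Polynomial.degree r \<le> Polynomial.degree q)"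
      using ex_has_least_nat[of "\<lambda>q. q \<in> I \<and> q \<notin> lin_span ?P f k" "s M" Polynomial.degree]
      by blast
  qed
  then obtain f where f: "\<And>k. f k \<in> I" "\<And>k. f k \<notin> lin_span ?P f k"
      "\<And>k q. q \<in> I \<Longrightarrow> q \<notin> lin_span ?P f k \<Longrightarrow> Polynomial.degree (f k) \<le> Polynomial.degree q"
    by blast
  have fP: "f k \<in> ?P" for k using f(1) idI by (auto simp: ideal_in_def)
  have deg: "Polynomial.degree (f i) \<le> Polynomial.degree (f n)" if "i \<le> n" for i n
    using f(3)[of "f n" i] f(1)[of n] f(2)[of n] P.lin_span_mono[of n f i] fP that by blast
  have "lead_coeff (f i) \<in> R" for i using fP by (auto simp: polys_over_def)
  then obtain n where "lead_coeff (f n) \<in> lin_span R (\<lambda>i. lead_coeff (f i)) n"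
    by (elim noetherianE[OF noeth, of "\<lambda>i. lead_coeff (f i)"]) auto
  then obtain a where a: "\<And>i. i < n \<Longrightarrow> a i \<in> R"
      "lead_coeff (f n) = (\<Sum>i<n. a i * lead_coeff (f i))"
    by (auto simp: lin_span_def)
  define d where "d i = Polynomial.degree (f i)" for i
  \<comment> \<open>\<open>g\<close> imitates the leading term of \<open>f n\<close>: the monomials
    raise each \<open>f i\<close> to degree \<open>d n\<close>, which is possible because the
    degrees never decrease.\<close>
  define g where "g = (\<Sum>i<n. Polynomial.monom (a i) (d n - d i) * f i)"
  have g: "g \<in> lin_span ?P f n"
    using a by (intro lin_spanI[OF g_def]) (auto simp: polys_over_def)
  have idf: "ideal_in (lin_span ?P f n) ?P" using fP by (intro P.ideal_in_lin_span)
  have gI: "g \<in> I" using lin_span_least[OF idI, of n f] f(1) g by blast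
  have "- 1 \<in> ?P" by simp
  then have "(- 1) * g \<in> I" using idI gI unfolding ideal_in_def by blast
  then have hI: "f n - g \<in> I" using idI f(1)[of n] unfolding ideal_in_def
    by (metis diff_conv_add_uminus mult_minus1)
  have hn: "f n - g \<notin> lin_span ?P f n"
  proof
    assume "f n - g \<in> lin_span ?P f n"
    then have "(f n - g) + g \<in> lin_span ?P f n" using g idf unfolding ideal_in_def by blast
    then show False using f(2) by simp
  qed
  have "Polynomial.degree (Polynomial.monom (a i) (d n - d i) * f i) \<le> d n" if "i < n" for i
  proof -
    have "Polynomial.degree (Polynomial.monom (a i) (d n - d i) * f i)
        \<le> Polynomial.degree (Polynomial.monom (a i) (d n - d i)) + d i"
      by (simp add: degree_mult_le d_def)
    also have "\<dots> \<le> (d n - d i) + d i" by (simp add: degree_monom_le)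
    finally show ?thesis using deg[of i n] that by (simp add: d_def)
  qed
  then have "Polynomial.degree g \<le> d n" unfolding g_def by (intro degree_sum_le) auto
  then have le: "Polynomial.degree (f n - g) \<le> d n" by (intro degree_diff_le) (auto simp: d_def)
  have "Polynomial.coeff g (d n) = (\<Sum>i<n. a i * lead_coeff (f i))"
    unfolding g_def coeff_sum
  proof (intro sum.cong refl)
    fix i assume "i \<in> {..<n}"
    then have "d i \<le> d n" using deg[of i n] by (auto simp: d_def)
    then have "d n - (d n - d i) = d i" by simp
    then show "Polynomial.coeff (Polynomial.monom (a i) (d n - d i) * f i) (d n)
        = a i * lead_coeff (f i)"
      by (simp add: coeff_monom_mult d_def)
  qed
  then have "Polynomial.coeff (f n - g) (d n) = 0" using a by (simp add: d_def)
  \<comment> \<open>The minimality of \<open>f n\<close> forbids a drop in degree, although the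
    coefficient at \<open>d n\<close> has been cancelled. Hence \<open>f n - g\<close> vanishes, but
    0 lies in every ideal.\<close>
  moreover have "Polynomial.degree (f n - g) = d n"
    using le f(3)[OF hI hn] by (simp add: d_def)
  ultimately have "f n - g = 0" by (metis leading_coeff_0_iff)
  then show False using hn idf by (simp add: ideal_in_def)
qed

text \<open>Evaluation carries a relation between chosen preimages to one between the
  values.\<close>

lemma noetherian_image_poly:
  assumes "noetherian S"
  shows "noetherian ((\<lambda>p. poly p y) ` S)"
  unfolding noetherian_def
proof (intro allI impI)
  fix s :: "nat \<Rightarrow> 'a" assume "\<forall>i. s i \<in> (\<lambda>p. poly p y) ` S"
  then have "\<forall>i. \<exists>p\<in>S. s i = poly p y" by auto
  then obtain p where p: "\<And>i. p i \<in> S" "\<And>i. s i = poly (p i) y" by metis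
  then obtain n where "p n \<in> lin_span S p n" using noetherianE[OF assms] by blast
  then obtain a where a: "\<And>i. i < n \<Longrightarrow> a i \<in> S" "p n = (\<Sum>i<n. a i * p i)"
    by (auto simp: lin_span_def)
  then have "s n = (\<Sum>i<n. poly (a i) y * s i)" "\<forall>i<n. poly (a i) y \<in> (\<lambda>p. poly p y) ` S"
    by (simp_all add: p(2) poly_sum)
  then show "\<exists>n. s n \<in> lin_span ((\<lambda>p. poly p y) ` S) s n"
    by (intro exI[of _ n]) (auto simp: lin_span_def)
qed

lemma unital_subring_image_poly:
  assumes "unital_subring S"
  shows "unital_subring ((\<lambda>p. poly p y) ` S)"
proof -
  interpret unital_subring S by fact
  show ?thesis
  proof
    show "0 \<in> (\<lambda>p. poly p y) ` S" by (rule image_eqI[of _ _ 0]) auto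
    show "1 \<in> (\<lambda>p. poly p y) ` S" by (rule image_eqI[of _ _ 1]) auto
  qed (auto simp flip: poly_add poly_mult poly_minus)
qed

text \<open>A first term 0 is the empty sum, and a nonzero first term divides the second one; so
  \<open>n\<close> is 0 or 1.\<close>

lemma noetherian_subfield:
  assumes "\<And>a b :: 'a::field. a \<in> R \<Longrightarrow> b \<in> R \<Longrightarrow> a / b \<in> R"
  shows "noetherian R"
  unfolding noetherian_def
proof (intro allI impI)
  fix s :: "nat \<Rightarrow> 'a" assume s: "\<forall>i. s i \<in> R"
  show "\<exists>n. s n \<in> lin_span R s n"
  proof (cases "s 0 = 0")
    case True
    then have "s 0 \<in> lin_span R s 0" by (simp add: lin_span_def)
    then show ?thesis by blast
  next
    case False
    then have "s 1 \<in> lin_span R s 1"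
      using s assms by (auto simp: lin_span_def intro!: exI[of _ "\<lambda>i. s 1 / s 0"])
    then show ?thesis by blast
  qed
qed

section \<open>Subrings, ideals and prime ideals in the language of abstract rings\<close>

lemma ring_on_simps [simp]:
  "carrier (ring_on R) = R" "x \<otimes>\<^bsub>ring_on R\<^esub> y = x * y" "x \<oplus>\<^bsub>ring_on R\<^esub> y = x + y"
  "\<one>\<^bsub>ring_on R\<^esub> = 1" "\<zero>\<^bsub>ring_on R\<^esub> = 0"
  by (simp_all add: ring_on_def)

lemma cring_ring_on:
  assumes "unital_subring R"
  shows "cring (ring_on R)"
proof -
  interpret unital_subring R by fact
  show ?thesis
  proof (rule cringI)
    show "abelian_group (ring_on R)"
    proof (rule abelian_groupI)
      fix x assume "x \<in> carrier (ring_on R)"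
      then show "\<exists>y\<in>carrier (ring_on R). y \<oplus>\<^bsub>ring_on R\<^esub> x = \<zero>\<^bsub>ring_on R\<^esub>"
        by (intro bexI[of _ "- x"]) auto
    qed (auto simp: algebra_simps)
    show "Group.comm_monoid (ring_on R)"
      by (rule comm_monoidI) (auto simp: algebra_simps)
  qed (auto simp: algebra_simps)
qed

lemma a_inv_ring_on:
  assumes "unital_subring R" "x \<in> R"
  shows "\<ominus>\<^bsub>ring_on R\<^esub> x = - x"
proof -
  interpret cring "ring_on R" using assms by (intro cring_ring_on)
  show ?thesis
    using assms by (intro minus_equality) (auto simp: unital_subring.uminus_closed)
qed

lemma unital_subring_UNIV: "unital_subring UNIV"
  by unfold_locales auto

lemma subring_ring_on_iff: "subring R (ring_on UNIV) \<longleftrightarrow> unital_subring R"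
proof -
  interpret cring "ring_on (UNIV :: 'a set)" by (intro cring_ring_on unital_subring_UNIV)
  note minus = a_inv_ring_on[OF unital_subring_UNIV UNIV_I]
  show ?thesis
  proof
    assume "subring R (ring_on UNIV)"
    then show "unital_subring R"
      using subringE(2,3,5,6,7)[of R "ring_on UNIV"] by unfold_locales (auto simp: minus)
  next
    assume "unital_subring R"
    then interpret S: unital_subring R .
    show "subring R (ring_on UNIV)"
      by (rule subringI) (auto simp: minus)
  qed
qed

lemma Units_ring_on: "Units (ring_on R) = {u \<in> R. u \<noteq> 0 \<and> inverse u \<in> R}"
proof -
  have "(\<exists>x\<in>R. x * u = 1 \<and> u * x = 1) \<longleftrightarrow> u \<noteq> 0 \<and> inverse u \<in> R" for u :: 'a
    by (metis inverse_unique left_inverse mult_zero_left mult_zero_right right_inverse zero_neq_one)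
  then show ?thesis by (auto simp: Units_def)
qed

lemma max_ideal_eq: "max_ideal R = {u \<in> R. u = 0 \<or> inverse u \<notin> R}"
  by (auto simp: max_ideal_def Units_ring_on)

lemma ideal_ring_on_iff:
  assumes "unital_subring R"
  shows "ideal I (ring_on R) \<longleftrightarrow> ideal_in I R"
proof -
  interpret unital_subring R by fact
  interpret A: cring "ring_on R" using assms by (rule cring_ring_on)
  show ?thesis
  proof
    assume "ideal I (ring_on R)"
    then interpret I: ideal I "ring_on R" .
    show "ideal_in I R"
      using I.a_subset I.zero_closed I.a_closed I.I_l_closed by (auto simp: ideal_in_def)
  next
    assume I: "ideal_in I R"
    have neg: "- x \<in> I" if "x \<in> I" for x
    proof -
      have "(- 1) * x \<in> I" using I that unfolding ideal_in_def by (meson one_closed uminus_closed)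
      then show ?thesis by simp
    qed
    have "subgroup I (add_monoid (ring_on R))"
    proof (rule A.add.subgroupI)
      show "I \<subseteq> carrier (ring_on R)" "I \<noteq> {}" using I by (auto simp: ideal_in_def)
      show "\<ominus>\<^bsub>ring_on R\<^esub> a \<in> I" if "a \<in> I" for a
        using I that neg by (subst a_inv_ring_on[OF assms]) (auto simp: ideal_in_def)
    qed (use I in \<open>auto simp: ideal_in_def\<close>)
    then show "ideal I (ring_on R)"
      using I A.ring_axioms by (intro idealI) (auto simp: ideal_in_def, metis mult.commute)
  qed
qed

lemma primeideal_ring_on_iff:
  assumes "unital_subring R"
  shows "primeideal P (ring_on R) \<longleftrightarrow>
    ideal_in P R \<and> 1 \<notin> P \<and> (\<forall>a\<in>R. \<forall>b\<in>R. a * b \<in> P \<longrightarrow> a \<in> P \<or> b \<in> P)"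
proof
  assume P: "primeideal P (ring_on R)"
  then interpret primeideal P "ring_on R" .
  have "1 \<notin> P" using one_imp_carrier I_notcarr by auto
  then show "ideal_in P R \<and> 1 \<notin> P \<and> (\<forall>a\<in>R. \<forall>b\<in>R. a * b \<in> P \<longrightarrow> a \<in> P \<or> b \<in> P)"
    using I_prime ideal_axioms ideal_ring_on_iff[OF assms] by auto
next
  assume "ideal_in P R \<and> 1 \<notin> P \<and> (\<forall>a\<in>R. \<forall>b\<in>R. a * b \<in> P \<longrightarrow> a \<in> P \<or> b \<in> P)"
  then show "primeideal P (ring_on R)"
    using assms unital_subring.one_closed[OF assms]
    by (intro primeidealI cring_ring_on) (auto simp: ideal_ring_on_iff)
qed

section \<open>Finitely generated algebras\<close>

lemma unital_subring_generate_ring: "unital_subring (generate_ring (ring_on UNIV) T)"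
proof -
  interpret cring "ring_on (UNIV :: 'a set)" by (intro cring_ring_on unital_subring_UNIV)
  show ?thesis unfolding subring_ring_on_iff[symmetric] by (rule generate_ring_is_subring) simp
qed

lemma generate_ring_least:
  assumes "unital_subring R" "T \<subseteq> R"
  shows "generate_ring (ring_on UNIV) T \<subseteq> R"
proof -
  interpret cring "ring_on (UNIV :: 'a set)" by (intro cring_ring_on unital_subring_UNIV)
  show ?thesis
    using assms by (intro generate_ring_min_subring1) (auto simp: subring_ring_on_iff)
qed

text \<open>In this form Hilbert's basis theorem enters the induction on generators: adjoining one
  element is evaluating polynomials at it.\<close>

lemma generate_ring_insert:
  "generate_ring (ring_on UNIV) (insert y T) =
     (\<lambda>p. poly p y) ` polys_over (generate_ring (ring_on UNIV) T)"
proof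
  let ?A = "generate_ring (ring_on UNIV) T"
  have sub: "unital_subring ((\<lambda>p. poly p y) ` polys_over ?A)"
    by (intro unital_subring_image_poly unital_subring_polys_over unital_subring_generate_ring)
  interpret A: unital_subring ?A by (rule unital_subring_generate_ring)
  have "y \<in> (\<lambda>p. poly p y) ` polys_over ?A"
    by (rule image_eqI[of _ _ "[:0, 1:]"]) (auto simp: polys_over_def coeff_pCons split: nat.split)
  moreover have "t \<in> (\<lambda>p. poly p y) ` polys_over ?A" if "t \<in> T" for t
    using that by (intro image_eqI[of _ _ "[:t:]"])
      (auto simp: polys_over_def coeff_pCons generate_ring.incl split: nat.split)
  ultimately show "generate_ring (ring_on UNIV) (insert y T) \<subseteq> (\<lambda>p. poly p y) ` polys_over ?A"
    by (intro generate_ring_least sub) auto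
  interpret B: unital_subring "generate_ring (ring_on UNIV) (insert y T)"
    by (rule unital_subring_generate_ring)
  have "?A \<subseteq> generate_ring (ring_on UNIV) (insert y T)"
    by (intro generate_ring_least unital_subring_generate_ring) (auto intro: generate_ring.incl)
  moreover have "y \<in> generate_ring (ring_on UNIV) (insert y T)" by (auto intro: generate_ring.incl)
  ultimately show "(\<lambda>p. poly p y) ` polys_over ?A \<subseteq> generate_ring (ring_on UNIV) (insert y T)"
    by (auto simp: poly_altdef polys_over_def intro!: B.sum_closed B.mult_closed)
qed

lemma unital_subring_affine_algebra: "affine_algebra \<iota> A \<Longrightarrow> unital_subring A"
  by (auto simp: affine_algebra_def unital_subring_generate_ring)

text \<open>Induction on a finite set of generators, starting from \<open>range \<iota>\<close>,
  which is a field.\<close>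

lemma noetherian_affine_algebra:
  assumes "\<iota> \<in> ring_hom (ring_on UNIV) (ring_on UNIV)" "affine_algebra \<iota> A"
  shows "noetherian A"
proof -
  have hom: "\<iota> (a + b) = \<iota> a + \<iota> b" "\<iota> (a * b) = \<iota> a * \<iota> b" "\<iota> 1 = 1" for a b
    using assms(1) by (auto simp: ring_hom_def)
  have zero: "\<iota> 0 = 0"
    using hom(1)[of 0 0] by (metis add_cancel_right_right add_0)
  have "\<iota> a + \<iota> (- a) = 0" for a using hom(1)[of a "- a"] zero by simp
  then have minus: "- \<iota> a = \<iota> (- a)" for a by (simp add: minus_unique)
  have inv: "inverse (\<iota> a) = \<iota> (inverse a)" for a
  proof (cases "a = 0")
    case False
    then have "\<iota> a * \<iota> (inverse a) = 1" by (simp flip: hom)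
    then show ?thesis by (rule inverse_unique)
  qed (simp add: zero)
  have sub: "unital_subring (range \<iota>)"
  proof
    show "0 \<in> range \<iota>" "1 \<in> range \<iota>" using zero hom(3) by (metis rangeI)+
  qed (auto simp: minus simp flip: hom)
  obtain S where "finite S" and A: "A = generate_ring (ring_on UNIV) (range \<iota> \<union> S)"
    using assms(2) by (auto simp: affine_algebra_def)
  from \<open>finite S\<close> have "noetherian (generate_ring (ring_on UNIV) (range \<iota> \<union> S))"
  proof induction
    case empty
    have "generate_ring (ring_on UNIV) (range \<iota>) = range \<iota>"
      using generate_ring_least[OF sub order_refl] by (auto intro: generate_ring.incl)
    moreover have "noetherian (range \<iota>)"
      by (intro noetherian_subfield) (auto simp: divide_inverse inv simp flip: hom)
    ultimately show ?case by simp
  next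
    case (insert y S)
    then show ?case
      by (auto simp: generate_ring_insert
          intro!: noetherian_image_poly noetherian_polys_over unital_subring_generate_ring)
  qed
  then show ?thesis by (simp add: A)
qed

section \<open>Discrete valuation rings\<close>

context
  fixes E :: "'a::field set"
  assumes sub: "unital_subring E"
begin

interpretation unital_subring E by (fact sub)

lemma Units_mult_closed:
  "u \<in> Units (ring_on E) \<Longrightarrow> v \<in> Units (ring_on E) \<Longrightarrow> u * v \<in> Units (ring_on E)"
  by (simp add: Units_ring_on)

lemma Units_inverse_closed: "u \<in> Units (ring_on E) \<Longrightarrow> inverse u \<in> Units (ring_on E)"
  by (simp add: Units_ring_on)

lemma Units_powi_closed: "u \<in> Units (ring_on E) \<Longrightarrow> u powi k \<in> Units (ring_on E)"
  by (auto simp: Units_ring_on power_int_def simp flip: power_inverse)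

text \<open>If the exponents differed, cancelling powers would make \<open>t\<close> a divisor of a
  unit, hence invertible in \<open>E\<close>, although it lies in the maximal ideal.\<close>

lemma unit_times_powi_unique:
  assumes u: "u \<in> Units (ring_on E)" "v \<in> Units (ring_on E)"
    and t: "t \<in> max_ideal E" "t \<noteq> 0" and eq: "u * t powi k = v * t powi l"
  shows "k = l"
proof -
  have le: "k \<le> l" if u: "u \<in> Units (ring_on E)" "v \<in> Units (ring_on E)"
    and eq: "u * t powi k = v * t powi l" for u v k l
  proof (rule ccontr)
    assume "\<not> k \<le> l"
    then have "l + 1 \<le> k" by simp
    then obtain n where k: "k = l + 1 + int n" by (auto simp: zle_iff_zadd)
    then have "t powi k = t powi l * t * t ^ n" using t by (simp add: power_int_add)
    then have "u * t * t ^ n = v" using eq t by (simp add: field_simps)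
    then have "t * (u * t ^ n * inverse v) = 1" using u by (auto simp: Units_ring_on field_simps)
    then have "inverse t = u * t ^ n * inverse v" by (rule inverse_unique)
    moreover have "u * t ^ n * inverse v \<in> E" using u t by (auto simp: Units_ring_on max_ideal_eq)
    ultimately show False using t by (simp add: max_ideal_eq)
  qed
  show ?thesis using le[OF u eq] le[OF u(2,1) eq[symmetric]] by simp
qed

end

text \<open>The condition \<open>t \<noteq> 0\<close> excludes fields, whose maximal ideal is zero.
  The factorisation is demanded for all nonzero elements of the ambient field, which is thereby the
  fraction field of \<open>E\<close>.\<close>

definition dvring :: "'a::field set \<Rightarrow> bool" where
  "dvring E \<longleftrightarrow> unital_subring E \<and> (\<exists>t. t \<noteq> 0 \<and> max_ideal E = (\<lambda>a. t * a) ` E \<and>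
     (\<forall>\<phi>. \<phi> \<noteq> 0 \<longrightarrow> (\<exists>k u. u \<in> Units (ring_on E) \<and> \<phi> = u * t powi k)))"

text \<open>The description in \<open>val\<close> ranges over all generators of the maximal ideal.
  Two of them differ by a unit, whose power is absorbed into the unit factor, so the exponent is the
  same.\<close>

lemma dvring_val_eqI:
  assumes "dvring E" "max_ideal E = (\<lambda>a. t * a) ` E" "u \<in> Units (ring_on E)" "\<phi> = u * t powi k"
  shows "val E \<phi> = k"
  unfolding val_def
proof (rule the_equality)
  show "\<exists>t u. max_ideal E = (\<lambda>a. t * a) ` E \<and> u \<in> Units (ring_on E) \<and> \<phi> = u * t powi k"
    using assms by blast
next
  fix l assume "\<exists>t u. max_ideal E = (\<lambda>a. t * a) ` E \<and> u \<in> Units (ring_on E) \<and> \<phi> = u * t powi l"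
  then obtain s v where s: "max_ideal E = (\<lambda>a. s * a) ` E" "v \<in> Units (ring_on E)" "\<phi> = v * s powi l"
    by blast
  have sub: "unital_subring E" using assms by (simp add: dvring_def)
  interpret unital_subring E by (fact sub)
  obtain t0 where "t0 \<noteq> 0" "max_ideal E = (\<lambda>a. t0 * a) ` E"
    using assms by (auto simp: dvring_def)
  then have "\<exists>x\<in>max_ideal E. x \<noteq> 0" by (metis image_eqI mult.right_neutral one_closed)
  then have nz: "t \<noteq> 0" "s \<noteq> 0" using assms(2) s(1) by auto
  have mem: "t \<in> max_ideal E" "s \<in> max_ideal E"
    using assms(2) s(1) one_closed by (metis image_eqI mult.right_neutral)+
  obtain c where c: "s = t * c" "c \<in> E" using mem assms(2) by auto
  obtain d where d: "t = s * d" "d \<in> E" using mem s(1) by auto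
  have "c * d = 1" using c(1) d(1) nz by (metis mult.assoc mult_cancel_left2)
  then have "c \<in> Units (ring_on E)"
    using c d by (auto simp: Units_ring_on inverse_unique)
  then have "v * c powi l \<in> Units (ring_on E)"
    using s by (intro Units_mult_closed Units_powi_closed sub)
  moreover have "u * t powi k = (v * c powi l) * t powi l"
    using assms(4) s(3) c(1) by (simp add: power_int_mult_distrib mult_ac)
  ultimately show "l = k"
    using unit_times_powi_unique[OF sub assms(3) _ mem(1) nz(1)] by metis
qed

lemma dvringE:
  assumes "dvring E"
  obtains t where "t \<noteq> 0" "max_ideal E = (\<lambda>a. t * a) ` E"
    "\<forall>\<phi>. \<phi> \<noteq> 0 \<longrightarrow> (\<exists>u\<in>Units (ring_on E). \<phi> = u * t powi val E \<phi>)"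
  using assms dvring_val_eqI[OF assms] unfolding dvring_def by metis

lemma unital_subring_dvring: "dvring E \<Longrightarrow> unital_subring E"
  by (simp add: dvring_def)

lemma val_mult:
  assumes "dvring E" "\<phi> \<noteq> 0" "\<psi> \<noteq> 0"
  shows "val E (\<phi> * \<psi>) = val E \<phi> + val E \<psi>"
proof -
  obtain t where t: "t \<noteq> 0" "max_ideal E = (\<lambda>a. t * a) ` E"
    "\<forall>\<phi>. \<phi> \<noteq> 0 \<longrightarrow> (\<exists>u\<in>Units (ring_on E). \<phi> = u * t powi val E \<phi>)"
    using assms(1) by (rule dvringE)
  obtain u v where "u \<in> Units (ring_on E)" "\<phi> = u * t powi val E \<phi>"
      "v \<in> Units (ring_on E)" "\<psi> = v * t powi val E \<psi>"
    using t(3) assms(2,3) by meson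
  then have "\<phi> * \<psi> = (u * v) * t powi (val E \<phi> + val E \<psi>)" "u * v \<in> Units (ring_on E)"
    using t(1) assms(1)
    by (auto simp: power_int_add Units_mult_closed unital_subring_dvring) (metis mult.assoc mult.left_commute)
  then show ?thesis using dvring_val_eqI[OF assms(1) t(2)] by blast
qed

lemma val_one: "dvring E \<Longrightarrow> val E 1 = 0"
  using val_mult[of E 1 1] by simp

lemma val_inverse: "dvring E \<Longrightarrow> \<phi> \<noteq> 0 \<Longrightarrow> val E (inverse \<phi>) = - val E \<phi>"
  using val_mult[of E \<phi> "inverse \<phi>"] val_one[of E] by simp

lemma val_power: "dvring E \<Longrightarrow> \<phi> \<noteq> 0 \<Longrightarrow> val E (\<phi> ^ n) = int n * val E \<phi>"
  by (induction n) (simp_all add: val_one val_mult algebra_simps)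

lemma dvring_mem_iff:
  assumes "dvring E" "\<phi> \<noteq> 0"
  shows "\<phi> \<in> E \<longleftrightarrow> 0 \<le> val E \<phi>"
proof -
  have sub: "unital_subring E" using assms by (simp add: dvring_def)
  interpret unital_subring E by (fact sub)
  obtain t where t: "t \<noteq> 0" "max_ideal E = (\<lambda>a. t * a) ` E"
    "\<forall>\<phi>. \<phi> \<noteq> 0 \<longrightarrow> (\<exists>u\<in>Units (ring_on E). \<phi> = u * t powi val E \<phi>)"
    using assms(1) by (rule dvringE)
  have tm: "t \<in> max_ideal E" using t(2) by (metis image_eqI mult.right_neutral one_closed)
  have nonneg: "\<psi> \<in> E" if \<psi>: "0 \<le> val E \<psi>" "\<psi> \<noteq> 0" for \<psi>
  proof -
    obtain u where u: "u \<in> Units (ring_on E)" "\<psi> = u * t powi val E \<psi>"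
      using t(3) \<psi>(2) by blast
    have "t powi val E \<psi> \<in> E" using \<psi>(1) tm by (auto simp: power_int_def max_ideal_eq)
    then have "u * t powi val E \<psi> \<in> E" using u(1) by (intro mult_closed) (auto simp: Units_ring_on)
    then show ?thesis using u(2) by simp
  qed
  have "0 \<le> val E \<phi>" if "\<phi> \<in> E"
  proof (rule ccontr)
    assume neg: "\<not> 0 \<le> val E \<phi>"
    then have "inverse \<phi> \<in> E" using nonneg[of "inverse \<phi>"] assms by (simp add: val_inverse)
    then have "\<phi> \<in> Units (ring_on E)" using that assms(2) by (simp add: Units_ring_on)
    then have "val E \<phi> = 0" using dvring_val_eqI[OF assms(1) t(2), of \<phi> \<phi> 0] by simp
    then show False using neg by simp
  qed
  then show ?thesis using nonneg assms(2) by blast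
qed

lemma dvring_max_ideal_iff:
  assumes "dvring E" "\<phi> \<noteq> 0"
  shows "\<phi> \<in> max_ideal E \<longleftrightarrow> 0 < val E \<phi>"
  using assms dvring_mem_iff[of E \<phi>] dvring_mem_iff[of E "inverse \<phi>"]
  by (auto simp: max_ideal_eq val_inverse)

lemma ideal_in_max_ideal_dvring:
  assumes "dvring E"
  shows "ideal_in (max_ideal E) E"
proof -
  interpret unital_subring E using assms by (rule unital_subring_dvring)
  obtain t where "t \<noteq> 0" "max_ideal E = (\<lambda>a. t * a) ` E"
    using assms by (auto simp: dvring_def)
  then have m: "x \<in> max_ideal E \<longleftrightarrow> x / t \<in> E" for x by (auto intro: image_eqI[of _ _ "x / t"])
  have "max_ideal E \<subseteq> E" by (auto simp: max_ideal_eq)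
  then show ?thesis
    by (auto simp: ideal_in_def m add_divide_distrib simp flip: times_divide_eq_right)
qed

lemma dvring_local_subring: "dvring E \<Longrightarrow> local_subring E"
  by (simp add: local_subring_def subring_ring_on_iff ideal_ring_on_iff unital_subring_dvring
      ideal_in_max_ideal_dvring)

text \<open>This makes the valuative criterion in \<open>proper_birational\<close> applicable to
  \<open>E\<close>.\<close>

lemma dvring_valuation_subring:
  assumes "dvring E"
  shows "valuation_subring E"
  unfolding valuation_subring_def
proof (intro conjI allI)
  interpret unital_subring E using assms by (rule unital_subring_dvring)
  show "subring E (ring_on UNIV)"
    using assms by (simp add: subring_ring_on_iff unital_subring_dvring)
  show "\<phi> \<in> E \<or> inverse \<phi> \<in> E" for \<phi>
    using assms dvring_mem_iff[of E \<phi>] dvring_mem_iff[of E "inverse \<phi>"] val_inverse[of E \<phi>]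
    by (cases "\<phi> = 0") auto
qed

text \<open>An element outside \<open>E\<close> has negative value, so dividing any given
  \<open>\<chi>\<close> by a high power of it leads into \<open>E\<close>.\<close>

lemma dvring_maximal_subring:
  assumes E: "dvring E" and R: "unital_subring R" "E \<subseteq> R" "R \<noteq> E"
  shows "R = UNIV"
proof -
  interpret unital_subring R by fact
  obtain \<phi> where \<phi>: "\<phi> \<in> R" "\<phi> \<notin> E" using R by auto
  then have nz: "\<phi> \<noteq> 0" using unital_subring.zero_closed[OF unital_subring_dvring[OF E]] by auto
  then have neg: "val E \<phi> < 0" using dvring_mem_iff[OF E nz] \<phi>(2) by auto
  have "\<chi> \<in> R" if \<chi>: "\<chi> \<noteq> 0" for \<chi>
  proof -
    define n where "n = nat \<bar>val E \<chi>\<bar>"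
    have "val E (\<chi> * inverse \<phi> ^ n) = val E \<chi> - int n * val E \<phi>"
      using E nz \<chi> by (simp add: val_mult val_power val_inverse del: power_inverse)
    also have "\<dots> \<ge> val E \<chi> + int n"
      using mult_left_mono[of "val E \<phi>" "- 1" "int n"] neg by simp
    finally have "\<chi> * inverse \<phi> ^ n \<in> E"
      using dvring_mem_iff[OF E, of "\<chi> * inverse \<phi> ^ n"] nz \<chi> by (auto simp: n_def)
    then have "\<chi> * inverse \<phi> ^ n * \<phi> ^ n \<in> R" using R \<phi> by auto
    then show ?thesis using nz by (simp add: field_simps)
  qed
  then show ?thesis by (metis UNIV_eq_I zero_closed)
qed

text \<open>The classical dichotomy: \<open>\<psi>\<close> multiplies the maximal ideal into
  \<open>E\<close>. If it maps that ideal to itself, \<open>\<psi>\<close> is integral over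
  \<open>E\<close> and so belongs to \<open>E\<close>. Otherwise some \<open>t * \<psi>\<close> is a
  unit, and \<open>t\<close> generates the maximal ideal.\<close>

lemma dvring_criterion:
  assumes sub: "unital_subring E" and noeth: "noetherian E" and ic: "integrally_closed E"
    and frac: "\<And>\<phi>. \<exists>a\<in>E. \<exists>b\<in>E. b \<noteq> 0 \<and> \<phi> = a / b"
    and \<psi>: "\<psi> \<notin> E" "\<And>s. s \<in> max_ideal E \<Longrightarrow> s * \<psi> \<in> E"
    and q: "q \<in> max_ideal E" "q \<noteq> 0"
  shows "dvring E"
proof -
  interpret unital_subring E by fact
  have \<psi>0: "\<psi> \<noteq> 0" using \<psi>(1) by auto
  have "\<exists>t\<in>max_ideal E. t * \<psi> \<notin> max_ideal E"
  proof (rule ccontr)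
    assume "\<not> (\<exists>t\<in>max_ideal E. t * \<psi> \<notin> max_ideal E)"
    \<comment> \<open>The factor \<open>q\<close> keeps the powers of \<open>\<psi>\<close> inside
      \<open>E\<close>, where the chain condition applies. Cancelling it from the resulting relation
      leaves a monic equation for \<open>\<psi>\<close>.\<close>
    then have "q * \<psi> ^ n \<in> max_ideal E" for n
      by (induction n) (auto simp: q mult.assoc[symmetric] power_Suc2 simp del: power_Suc)
    then have "q * \<psi> ^ n \<in> E" for n by (simp add: max_ideal_eq)
    then obtain n where "q * \<psi> ^ n \<in> lin_span E (\<lambda>i. q * \<psi> ^ i) n"
      by (elim noetherianE[OF noeth, of "\<lambda>i. q * \<psi> ^ i"]) auto
    then obtain a where a: "\<And>i. i < n \<Longrightarrow> a i \<in> E" "q * \<psi> ^ n = (\<Sum>i<n. a i * (q * \<psi> ^ i))"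
      by (auto simp: lin_span_def)
    have "q * \<psi> ^ n = q * (\<Sum>i<n. a i * \<psi> ^ i)"
      unfolding a(2) sum_distrib_left by (intro sum.cong) auto
    then have rel: "\<psi> ^ n = (\<Sum>i<n. a i * \<psi> ^ i)" using q by simp
    define p where "p = Polynomial.monom 1 n - (\<Sum>i<n. Polynomial.monom (a i) i)"
    have coeff: "Polynomial.coeff p i = (if i = n then 1 else if i < n then - a i else 0)" for i
      by (auto simp: p_def coeff_sum)
    have "Polynomial.degree p = n"
      by (intro antisym degree_le le_degree) (auto simp: coeff)
    then have "lead_coeff p = 1" by (simp add: coeff)
    moreover have "\<forall>i. Polynomial.coeff p i \<in> E" using a by (auto simp: coeff)
    moreover have "poly p \<psi> = 0" by (simp add: p_def poly_sum poly_monom rel)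
    ultimately show False using ic \<psi>(1) by (auto simp: integrally_closed_def)
  qed
  then obtain t where t: "t \<in> max_ideal E" "t * \<psi> \<notin> max_ideal E" by auto
  then have unit: "t * \<psi> \<noteq> 0" "inverse (t * \<psi>) \<in> E"
    using \<psi>(2)[OF t(1)] by (auto simp: max_ideal_eq)
  have t0: "t \<noteq> 0" "t \<in> E" "inverse t \<notin> E" using unit t by (auto simp: max_ideal_eq)
  have max: "max_ideal E = (\<lambda>a. t * a) ` E"
  proof (intro equalityI subsetI)
    fix s assume "s \<in> max_ideal E"
    then have "s * \<psi> * inverse (t * \<psi>) \<in> E" using \<psi>(2) unit(2) mult_closed by blast
    moreover have "s = t * (s * \<psi> * inverse (t * \<psi>))" using t0 \<psi>0 by (simp add: field_simps)
    ultimately show "s \<in> (\<lambda>a. t * a) ` E" by blast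
  next
    fix s assume "s \<in> (\<lambda>a. t * a) ` E"
    then obtain a where a: "s = t * a" "a \<in> E" by auto
    have "inverse s \<notin> E" if "s \<noteq> 0"
    proof
      assume "inverse s \<in> E"
      then have "a * inverse s \<in> E" using a by auto
      moreover have "a * inverse s = inverse t" using a that by (simp add: field_simps)
      ultimately show False using t0 by simp
    qed
    then show "s \<in> max_ideal E" using a t0 by (auto simp: max_ideal_eq)
  qed
  \<comment> \<open>If no quotient by a power of \<open>t\<close> were a unit, all of them would
    stay in \<open>E\<close>. The chain condition for these quotients, divided by the last one,
    writes 1 as a multiple of \<open>t\<close>.\<close>
  have repr: "\<exists>k. \<phi> / t ^ k \<in> Units (ring_on E)" if \<phi>: "\<phi> \<in> E" "\<phi> \<noteq> 0" for \<phi>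
  proof (rule ccontr)
    assume nounit: "\<nexists>k. \<phi> / t ^ k \<in> Units (ring_on E)"
    have all: "\<phi> / t ^ k \<in> E" for k
    proof (induction k)
      case (Suc k)
      then have "\<phi> / t ^ k \<in> max_ideal E" using nounit by (auto simp: max_ideal_def)
      then obtain a where a: "\<phi> / t ^ k = t * a" "a \<in> E" using max by auto
      then have "\<phi> / t ^ Suc k = a" using t0 by (simp add: field_simps)
      then show ?case using a by simp
    qed (use \<phi> in simp)
    then obtain n where "\<phi> / t ^ n \<in> lin_span E (\<lambda>i. \<phi> / t ^ i) n"
      by (elim noetherianE[OF noeth, of "\<lambda>i. \<phi> / t ^ i"]) auto
    then obtain a where a: "\<And>i. i < n \<Longrightarrow> a i \<in> E" "\<phi> / t ^ n = (\<Sum>i<n. a i * (\<phi> / t ^ i))"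
      by (auto simp: lin_span_def)
    have "\<phi> / t ^ n = \<phi> / t ^ n * (\<Sum>i<n. a i * t ^ (n - i))"
      unfolding a(2) sum_distrib_left
    proof (subst a(2)[symmetric], intro sum.cong refl)
      fix i assume "i \<in> {..<n}"
      then have "t ^ n = t ^ (n - i) * t ^ i" by (simp flip: power_add)
      then show "a i * (\<phi> / t ^ i) = \<phi> / t ^ n * (a i * t ^ (n - i))" using t0 by simp
    qed
    then have "1 = (\<Sum>i<n. a i * t ^ (n - i))" using \<phi> t0 by simp
    also have "\<dots> = t * (\<Sum>i<n. a i * t ^ (n - i - 1))"
      unfolding sum_distrib_left
    proof (intro sum.cong refl)
      fix i assume "i \<in> {..<n}"
      then have "t ^ (n - i) = t * t ^ (n - i - 1)"
        using power_minus_mult[of "n - i" t] by (simp add: mult.commute)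
      then show "a i * t ^ (n - i) = t * (a i * t ^ (n - i - 1))" by simp
    qed
    finally have "inverse t = (\<Sum>i<n. a i * t ^ (n - i - 1))" by (metis inverse_unique)
    moreover have "(\<Sum>i<n. a i * t ^ (n - i - 1)) \<in> E" using a t0 by (intro sum_closed) auto
    ultimately show False using t0 by simp
  qed
  have "\<exists>k u. u \<in> Units (ring_on E) \<and> \<phi> = u * t powi k" if \<phi>: "\<phi> \<noteq> 0" for \<phi>
  proof -
    obtain a b where ab: "a \<in> E" "b \<in> E" "b \<noteq> 0" "\<phi> = a / b" using frac by blast
    then have "a \<noteq> 0" using \<phi> by auto
    obtain k l where kl: "a / t ^ k \<in> Units (ring_on E)" "b / t ^ l \<in> Units (ring_on E)"
      using repr ab \<open>a \<noteq> 0\<close> by meson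
    then have "(a / t ^ k) * inverse (b / t ^ l) \<in> Units (ring_on E)"
      using sub by (intro Units_mult_closed Units_inverse_closed)
    moreover have "\<phi> = ((a / t ^ k) * inverse (b / t ^ l)) * t powi (int k - int l)"
      using ab t0 by (simp add: power_int_diff)
    ultimately show ?thesis by blast
  qed
  then show ?thesis using sub t0 max by (auto simp: dvring_def)
qed

section \<open>Localisations\<close>

definition localisation :: "'a::field set \<Rightarrow> 'a set \<Rightarrow> 'a set" where
  "localisation A P = {a / b | a b. a \<in> A \<and> b \<in> A - P}"

context
  fixes A P :: "'a::field set"
  assumes A: "unital_subring A" and P: "primeideal P (ring_on A)"
begin

interpretation unital_subring A by (fact A)

lemma primeidealD:
  "ideal_in P A" "1 \<notin> P" "0 \<in> P" "P \<subseteq> A" "\<And>a b. a \<in> P \<Longrightarrow> b \<in> P \<Longrightarrow> a + b \<in> P"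
  "\<And>a b. a \<in> A \<Longrightarrow> b \<in> P \<Longrightarrow> a * b \<in> P"
  "\<And>a b. a \<in> A - P \<Longrightarrow> b \<in> A - P \<Longrightarrow> a * b \<in> A - P"
  using P unfolding primeideal_ring_on_iff[OF A] ideal_in_def by auto

lemma localisationI: "a \<in> A \<Longrightarrow> b \<in> A - P \<Longrightarrow> a / b \<in> localisation A P"
  by (auto simp: localisation_def)

lemma localisationE:
  assumes "x \<in> localisation A P"
  obtains a b where "a \<in> A" "b \<in> A - P" "b \<noteq> 0" "x = a / b"
  using assms primeidealD(3) by (auto simp: localisation_def)

lemma subset_localisation: "A \<subseteq> localisation A P"
  using localisationI[of _ 1] primeidealD(2) by auto

lemma unital_subring_localisation: "unital_subring (localisation A P)"
proof
  show "0 \<in> localisation A P" "1 \<in> localisation A P" using subset_localisation by auto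
next
  fix x assume "x \<in> localisation A P"
  then obtain a b where "a \<in> A" "b \<in> A - P" "b \<noteq> 0" "x = a / b" by (rule localisationE)
  then show "- x \<in> localisation A P" using localisationI[of "- a" b] by simp
next
  fix x y assume "x \<in> localisation A P" "y \<in> localisation A P"
  then obtain a b c d where x: "a \<in> A" "b \<in> A - P" "b \<noteq> 0" "x = a / b"
    and y: "c \<in> A" "d \<in> A - P" "d \<noteq> 0" "y = c / d" by (elim localisationE)
  have "b * d \<in> A - P" using x y by (intro primeidealD(7))
  then have "(a * d + c * b) / (b * d) \<in> localisation A P" "(a * c) / (b * d) \<in> localisation A P"
    using x y by (auto intro!: localisationI)
  then show "x + y \<in> localisation A P" "x * y \<in> localisation A P"
    using x y by (simp_all add: add_frac_eq)
qed

lemma max_ideal_localisation: "max_ideal (localisation A P) = {a / b | a b. a \<in> P \<and> b \<in> A - P}"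
proof (intro equalityI subsetI)
  fix x assume x: "x \<in> max_ideal (localisation A P)"
  then obtain a b where ab: "a \<in> A" "b \<in> A - P" "b \<noteq> 0" "x = a / b"
    by (auto simp: max_ideal_eq elim: localisationE)
  have "a \<in> P"
  proof (rule ccontr)
    assume "a \<notin> P"
    then have "inverse x \<in> localisation A P" "x \<noteq> 0"
      using ab localisationI[of b a] primeidealD(3) by auto
    then show False using x by (simp add: max_ideal_eq)
  qed
  then show "x \<in> {a / b | a b. a \<in> P \<and> b \<in> A - P}" using ab by auto
next
  fix x assume "x \<in> {a / b | a b. a \<in> P \<and> b \<in> A - P}"
  then obtain a b where ab: "a \<in> P" "b \<in> A - P" "x = a / b" by blast
  have b0: "b \<noteq> 0" using ab primeidealD(3) by auto
  have "x = 0" if inv: "inverse x \<in> localisation A P"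
  proof (rule ccontr)
    assume "x \<noteq> 0"
    obtain c d where cd: "c \<in> A" "d \<in> A - P" "d \<noteq> 0" "inverse x = c / d"
      using inv by (rule localisationE)
    have "b * d = c * a" using cd ab \<open>x \<noteq> 0\<close> b0 by (auto simp: field_simps)
    moreover have "c * a \<in> P" using cd ab primeidealD(6) by auto
    moreover have "b * d \<in> A - P" using cd ab by (intro primeidealD(7)) auto
    ultimately show False by auto
  qed
  then show "x \<in> max_ideal (localisation A P)"
    using ab primeidealD(4) by (auto simp: max_ideal_eq intro: localisationI)
qed

lemma local_subring_localisation: "local_subring (localisation A P)"
proof -
  let ?L = "localisation A P" and ?m = "{a / b | a b. a \<in> P \<and> b \<in> A - P}"
  have mI: "a / b \<in> ?m" if "a \<in> P" "b \<in> A - P" for a b using that by blast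
  have "ideal_in ?m ?L"
    unfolding ideal_in_def
  proof (intro conjI ballI)
    show "?m \<subseteq> ?L" using primeidealD(4) by (auto intro: localisationI)
    show "0 \<in> ?m" using mI[of 0 1] primeidealD(2,3) by auto
  next
    fix x y assume "x \<in> ?m" "y \<in> ?m"
    then obtain a b c d where x: "a \<in> P" "b \<in> A - P" "x = a / b"
      and y: "c \<in> P" "d \<in> A - P" "y = c / d" by blast
    have nz: "b \<noteq> 0" "d \<noteq> 0" using x y primeidealD(3) by auto
    have "d * a + b * c \<in> P" using x y primeidealD(5,6) by auto
    moreover have "b * d \<in> A - P" using x y by (intro primeidealD(7))
    ultimately have "(d * a + b * c) / (b * d) \<in> ?m" by (rule mI)
    then show "x + y \<in> ?m" using x y nz by (simp add: add_frac_eq mult.commute)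
  next
    fix x y assume "x \<in> ?L" "y \<in> ?m"
    then obtain a b c d where x: "a \<in> A" "b \<in> A - P" "x = a / b"
      and y: "c \<in> P" "d \<in> A - P" "y = c / d" unfolding localisation_def by blast
    have "a * c \<in> P" using x y primeidealD(6) by auto
    moreover have "b * d \<in> A - P" using x y by (intro primeidealD(7))
    ultimately have "(a * c) / (b * d) \<in> ?m" by (rule mI)
    then show "x * y \<in> ?m" using x y by simp
  qed
  then show ?thesis
    using unital_subring_localisation
    by (simp add: local_subring_def subring_ring_on_iff ideal_ring_on_iff max_ideal_localisation)
qed

text \<open>The chain condition is applied to the numerators; the factors \<open>b i / b n\<close>
  turn their relation into one between the fractions.\<close>

lemma noetherian_localisation:
  assumes "noetherian A"
  shows "noetherian (localisation A P)"
  unfolding noetherian_def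
proof (intro allI impI)
  fix s :: "nat \<Rightarrow> 'a" assume "\<forall>i. s i \<in> localisation A P"
  then have "\<forall>i. \<exists>a b. a \<in> A \<and> b \<in> A - P \<and> b \<noteq> 0 \<and> s i = a / b" by (metis localisationE)
  then obtain a b where ab: "\<And>i. a i \<in> A" "\<And>i. b i \<in> A - P" "\<And>i. b i \<noteq> 0" "\<And>i. s i = a i / b i"
    by metis
  obtain n where "a n \<in> lin_span A a n" using assms ab(1) by (rule noetherianE)
  then obtain c where c: "\<And>i. i < n \<Longrightarrow> c i \<in> A" "a n = (\<Sum>i<n. c i * a i)"
    by (auto simp: lin_span_def)
  have "s n = (\<Sum>i<n. (c i * b i / b n) * s i)"
    unfolding ab(4) c(2) sum_divide_distrib using ab(3) by (intro sum.cong) auto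
  then have "s n \<in> lin_span (localisation A P) s n"
    using ab c by (elim lin_spanI) (auto intro!: localisationI)
  then show "\<exists>n. s n \<in> lin_span (localisation A P) s n" by blast
qed

end

text \<open>
  The discrete valuation ring is the localisation at a prime ideal associated with the principal
  fractional ideal of \<open>\<phi>\<close>: a maximal one among the proper conductors of the multiples of
  \<open>\<phi>\<close> into the local ring.
\<close>
lemma normal_localisation_dvring:
  assumes A: "unital_subring A" and noeth: "noetherian A"
    and frac: "\<And>\<phi>. \<exists>a\<in>A. \<exists>b\<in>A. b \<noteq> 0 \<and> \<phi> = a / b"
    and normal: "\<And>Q. primeideal Q (ring_on A) \<Longrightarrow> integrally_closed (localisation A Q)"
    and P: "primeideal P (ring_on A)" and \<phi>: "\<phi> \<notin> localisation A P"
  obtains Q where "primeideal Q (ring_on A)" "localisation A P \<subseteq> localisation A Q"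
    "\<phi> \<notin> localisation A Q" "dvring (localisation A Q)"
proof -
  interpret unital_subring A by fact
  let ?L = "localisation A P"
  interpret L: unital_subring ?L using A P by (rule unital_subring_localisation)
  have AL: "A \<subseteq> ?L" using A P by (rule subset_localisation)
  define I where "I \<psi> = {r \<in> A. r * \<psi> \<in> ?L}" for \<psi>
  have idI: "ideal_in (I \<psi>) A" for \<psi>
    using AL by (auto simp: ideal_in_def I_def distrib_right mult.assoc)
  define \<F> where "\<F> = {I (c * \<phi>) | c. c \<in> ?L \<and> c * \<phi> \<notin> ?L}"
  have "1 * \<phi> \<notin> ?L" "1 \<in> ?L" using \<phi> by simp_all
  then have "\<F> \<noteq> {}" unfolding \<F>_def by blast
  moreover have "ideal_in J A" if "J \<in> \<F>" for J using that idI by (auto simp: \<F>_def)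
  ultimately obtain Q where Q: "Q \<in> \<F>" and Qmax: "\<And>J. J \<in> \<F> \<Longrightarrow> Q \<subseteq> J \<Longrightarrow> J = Q"
    using noetherian_maximal_ideal[OF noeth A] by metis
  obtain c where c: "c \<in> ?L" "c * \<phi> \<notin> ?L" and Q_eq: "Q = I (c * \<phi>)" using Q by (auto simp: \<F>_def)
  define \<psi> where "\<psi> = c * \<phi>"
  \<comment> \<open>An element of \<open>A\<close> outside \<open>P\<close> is invertible in
    \<open>?L\<close> and could be cancelled from \<open>r * \<psi>\<close>.\<close>
  have QP: "Q \<subseteq> P"
  proof
    fix r assume r: "r \<in> Q"
    show "r \<in> P"
    proof (rule ccontr)
      assume "r \<notin> P"
      then have "1 / r \<in> ?L" "r \<noteq> 0"
        using r localisationI[OF A P, of 1 r] primeidealD(3)[OF A P] by (auto simp: Q_eq I_def)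
      moreover have "r * \<psi> \<in> ?L" using r by (auto simp: Q_eq I_def \<psi>_def)
      ultimately have "1 / r * (r * \<psi>) \<in> ?L" using L.mult_closed by blast
      then show False using c \<open>r \<noteq> 0\<close> by (simp add: \<psi>_def)
    qed
  qed
  \<comment> \<open>If \<open>b\<close> is not in \<open>Q\<close>, then \<open>b * \<psi>\<close>
    is again a multiple of \<open>\<phi>\<close> outside \<open>?L\<close>. Its conductor contains
    \<open>Q\<close>, so equals \<open>Q\<close> by maximality, and it contains
    \<open>a\<close>.\<close>
  have "a \<in> Q \<or> b \<in> Q" if ab: "a \<in> A" "b \<in> A" "a * b \<in> Q" for a b
  proof (rule disjCI)
    assume "b \<notin> Q"
    then have "b * \<psi> \<notin> ?L" using ab by (auto simp: Q_eq I_def \<psi>_def)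
    then have "I (b * c * \<phi>) \<in> \<F>"
      unfolding \<F>_def using ab c AL by (auto simp: \<psi>_def mult.assoc intro!: exI[of _ "b * c"])
    moreover have "Q \<subseteq> I (b * c * \<phi>)"
    proof
      fix r assume "r \<in> Q"
      then have "r \<in> A" "r * \<psi> \<in> ?L" by (auto simp: Q_eq I_def \<psi>_def)
      then have "b * (r * \<psi>) \<in> ?L" using ab AL L.mult_closed by blast
      then show "r \<in> I (b * c * \<phi>)" using \<open>r \<in> A\<close> by (simp add: I_def \<psi>_def mult_ac)
    qed
    ultimately have "I (b * c * \<phi>) = Q" by (rule Qmax)
    moreover have "a \<in> I (b * c * \<phi>)" using ab by (auto simp: Q_eq I_def mult_ac)
    ultimately show "a \<in> Q" by simp
  qed
  then have Qprime: "primeideal Q (ring_on A)"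
    using idI[of "c * \<phi>"] primeidealD(2)[OF A P] QP
    unfolding primeideal_ring_on_iff[OF A] by (auto simp: Q_eq)
  let ?E = "localisation A Q"
  interpret E: unital_subring ?E using A Qprime by (rule unital_subring_localisation)
  have LE: "?L \<subseteq> ?E" using QP by (auto simp: localisation_def)
  \<comment> \<open>A denominator of \<open>\<psi>\<close> multiplies it into \<open>A\<close> and
    would therefore belong to the conductor \<open>Q\<close>.\<close>
  have \<psi>E: "\<psi> \<notin> ?E"
  proof
    assume "\<psi> \<in> ?E"
    then obtain a b where ab: "a \<in> A" "b \<in> A - Q" "b \<noteq> 0" "\<psi> = a / b"
      using localisationE[OF A Qprime] by blast
    then have "b * \<psi> \<in> ?L" using AL by auto
    then show False using ab by (auto simp: Q_eq I_def \<psi>_def)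
  qed
  have \<phi>E: "\<phi> \<notin> ?E"
  proof
    assume "\<phi> \<in> ?E"
    then have "c * \<phi> \<in> ?E" using c LE by (intro E.mult_closed) auto
    then show False using \<psi>E by (simp add: \<psi>_def)
  qed
  have AE: "A \<subseteq> ?E" using A Qprime by (rule subset_localisation)
  \<comment> \<open>A denominator of \<open>\<phi>\<close> supplies the nonzero element of the
    maximal ideal that \<open>dvring_criterion\<close> asks for: it must lie in \<open>Q\<close>, as
    \<open>\<phi>\<close> is not in \<open>?E\<close>.\<close>
  obtain a b where ab: "a \<in> A" "b \<in> A" "b \<noteq> 0" "\<phi> = a / b" using frac by blast
  then have "b \<in> Q" using \<phi>E localisationI[OF A Qprime, of a b] by auto
  moreover have "1 \<in> A - Q" using primeidealD(2)[OF A Qprime] by simp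
  ultimately have "b / 1 \<in> max_ideal ?E"
    unfolding max_ideal_localisation[OF A Qprime] by blast
  then have bm: "b \<in> max_ideal ?E" by simp
  have "dvring ?E"
  proof (rule dvring_criterion[OF E.unital_subring_axioms _ _ _ \<psi>E _ bm ab(3)])
    show "noetherian ?E" using noeth by (rule noetherian_localisation[OF A Qprime])
    show "integrally_closed ?E" using Qprime by (rule normal)
    show "\<exists>a\<in>?E. \<exists>b\<in>?E. b \<noteq> 0 \<and> \<chi> = a / b" for \<chi> using frac[of \<chi>] AE by blast
    show "s * \<psi> \<in> ?E" if sm: "s \<in> max_ideal ?E" for s
    proof -
      obtain a b where s: "a \<in> Q" "b \<in> A - Q" "s = a / b"
        using sm unfolding max_ideal_localisation[OF A Qprime] by blast
      have "a * \<psi> \<in> ?E" using s LE by (auto simp: Q_eq I_def \<psi>_def)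
      moreover have "1 / b \<in> ?E" using s by (intro localisationI[OF A Qprime]) auto
      ultimately have "1 / b * (a * \<psi>) \<in> ?E" using E.mult_closed by blast
      then show ?thesis using s by (simp add: field_simps)
    qed
  qed
  then show thesis using that Qprime LE \<phi>E by blast
qed

section \<open>Points of normal varieties\<close>

text \<open>The chart comes with all its points, because the discrete valuation ring sought later is
  another point of the same chart.\<close>

lemma normal_variety_pointE:
  assumes "normal_variety \<iota> X" "x \<in> X"
  obtains A P where "affine_algebra \<iota> A" "primeideal P (ring_on A)" "x = localisation A P"
    "\<forall>Q. primeideal Q (ring_on A) \<longrightarrow> localisation A Q \<in> X"
proof -
  obtain \<A> where \<A>: "\<forall>A\<in>\<A>. affine_algebra \<iota> A" "X = (\<Union>A\<in>\<A>. Spec_model A)"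
    using assms by (auto simp: normal_variety_def variety_def)
  have Spec: "Spec_model A = {localisation A P | P. primeideal P (ring_on A)}" for A :: "'a set"
    by (simp add: Spec_model_def localisation_def)
  obtain A where "A \<in> \<A>" "x \<in> Spec_model A" using \<A>(2) assms(2) by blast
  moreover from this obtain P where "primeideal P (ring_on A)" "x = localisation A P"
    by (auto simp: Spec)
  moreover have "localisation A Q \<in> X" if "primeideal Q (ring_on A)" for Q
    using that \<A>(2) \<open>A \<in> \<A>\<close> by (auto simp: Spec)
  ultimately show thesis using that \<A>(1) by blast
qed

lemma local_subring_point: "normal_variety \<iota> X \<Longrightarrow> x \<in> X \<Longrightarrow> local_subring x"
  by (metis normal_variety_pointE local_subring_localisation unital_subring_affine_algebra)

lemma unital_subring_point: "normal_variety \<iota> X \<Longrightarrow> x \<in> X \<Longrightarrow> unital_subring x"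
  using local_subring_point by (auto simp: local_subring_def subring_ring_on_iff)

lemma dvring_point_avoiding:
  assumes X: "normal_variety \<iota> X" and "x \<in> X" "\<phi> \<notin> x"
  obtains E where "E \<in> X" "x \<subseteq> E" "\<phi> \<notin> E" "dvring E"
proof -
  obtain A P where A: "affine_algebra \<iota> A" "primeideal P (ring_on A)" "x = localisation A P"
      "\<forall>Q. primeideal Q (ring_on A) \<longrightarrow> localisation A Q \<in> X"
    using X \<open>x \<in> X\<close> by (rule normal_variety_pointE)
  have "noetherian A"
    using noetherian_affine_algebra A(1) X by (auto simp: normal_variety_def variety_def)
  moreover have "\<exists>a\<in>A. \<exists>b\<in>A. b \<noteq> 0 \<and> \<chi> = a / b" for \<chi>
    using A(1) by (auto simp: affine_algebra_def)
  moreover have "integrally_closed (localisation A Q)" if "primeideal Q (ring_on A)" for Q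
    using A(4) that X by (auto simp: normal_variety_def)
  ultimately obtain Q where "primeideal Q (ring_on A)" "localisation A P \<subseteq> localisation A Q"
      "\<phi> \<notin> localisation A Q" "dvring (localisation A Q)"
    using normal_localisation_dvring[OF unital_subring_affine_algebra[OF A(1)] _ _ _ A(2)]
      \<open>\<phi> \<notin> x\<close> A(3) by metis
  then show thesis using that A(3,4) by blast
qed

lemma prime_divisor_if_dvring:
  assumes "normal_variety \<iota> X" "E \<in> X" "dvring E" "E \<noteq> UNIV"
  shows "prime_divisor X E"
  using assms dvring_maximal_subring[OF assms(3)] unital_subring_point[OF assms(1)]
  by (auto simp: prime_divisor_def)

text \<open>A discrete valuation ring in \<open>X\<close> that contains \<open>E\<close> and avoids
  some \<open>\<phi>\<close> is not \<open>UNIV\<close>; codimension one leaves only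
  \<open>E\<close> itself.\<close>

lemma dvring_prime_divisor:
  assumes "normal_variety \<iota> X" "prime_divisor X E"
  shows "dvring E"
proof -
  have "E \<in> X" "E \<noteq> UNIV" using assms(2) by (auto simp: prime_divisor_def)
  then obtain \<phi> where "\<phi> \<notin> E" by auto
  then obtain E' where "E' \<in> X" "E \<subseteq> E'" "\<phi> \<notin> E'" "dvring E'"
    using dvring_point_avoiding assms(1) \<open>E \<in> X\<close> by metis
  then show ?thesis using assms(2) by (auto simp: prime_divisor_def)
qed

lemma mem_point_if_mem_prime_divisors:
  assumes "normal_variety \<iota> X" "x \<in> X" "\<And>E. prime_divisor X E \<Longrightarrow> x \<subseteq> E \<Longrightarrow> \<phi> \<in> E"
  shows "\<phi> \<in> x"
proof (rule ccontr)
  assume "\<phi> \<notin> x"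
  then obtain E where E: "E \<in> X" "x \<subseteq> E" "\<phi> \<notin> E" "dvring E"
    using dvring_point_avoiding assms(1,2) by metis
  then have "prime_divisor X E" using assms(1) by (intro prime_divisor_if_dvring) auto
  then show False using assms(3) E by blast
qed

text \<open>The generating open sets require that an element be regular, and regularity persists in
  larger local rings.\<close>

lemma openin_zariski_generisation:
  assumes "openin (zariski X) U" "x \<in> U" "x \<subseteq> z" "z \<in> X"
  shows "z \<in> U"
proof -
  have "generate_topology_on {{x \<in> X. \<phi> \<in> x} | \<phi>. True} U"
    using assms(1) unfolding zariski_def by (rule openin_topology_generated_by)
  then show ?thesis using assms(2-4)
    by (induction U rule: generate_topology_on.induct) auto
qed

lemma topspace_zariski:
  assumes "normal_variety \<iota> X"
  shows "topspace (zariski X) = X"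
  using unital_subring.one_closed[OF unital_subring_point[OF assms]]
  by (auto simp: zariski_def)

lemma openin_zariski_space: "normal_variety \<iota> X \<Longrightarrow> openin (zariski X) X"
  by (metis openin_topspace topspace_zariski)

text \<open>Separatedness makes the dominated point unique, which justifies the definite
  description.\<close>

lemma center_pt_eq:
  assumes "normal_variety \<iota> X" "local_subring R" "x \<in> X" "dominates R x"
  shows "center_pt X R = x"
  unfolding center_pt_def
  using assms by (intro the_equality) (auto simp: normal_variety_def variety_def)

lemma dominates_trans: "dominates R S \<Longrightarrow> dominates S T \<Longrightarrow> dominates R T"
  by (auto simp: dominates_def)

section \<open>Stalks of divisorial sheaves\<close>

lemma stalk_div_sheaf_mult:
  assumes X: "normal_variety \<iota> X"
    and \<phi>: "\<phi> \<in> stalk X (div_sheaf X D) x" and \<psi>: "\<psi> \<in> stalk X (div_sheaf X D') x"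
  shows "\<phi> * \<psi> \<in> stalk X (div_sheaf X (\<lambda>E. D E + D' E)) x"
proof -
  obtain U U' where U: "openin (zariski X) U" "x \<in> U" "\<phi> \<in> div_sheaf X D U"
    and U': "openin (zariski X) U'" "x \<in> U'" "\<psi> \<in> div_sheaf X D' U'"
    using \<phi> \<psi> by (auto simp: stalk_def)
  have "0 \<le> val E (\<phi> * \<psi>) + (D E + D' E)"
    if "E \<in> U \<inter> U'" "prime_divisor X E" "\<phi> \<noteq> 0" "\<psi> \<noteq> 0" for E
  proof -
    have "0 \<le> val E \<phi> + D E" "0 \<le> val E \<psi> + D' E"
      using U(3) U'(3) that by (auto simp: div_sheaf_def)
    moreover have "val E (\<phi> * \<psi>) = val E \<phi> + val E \<psi>"
      using that X by (intro val_mult dvring_prime_divisor)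
    ultimately show ?thesis by simp
  qed
  then have "\<phi> * \<psi> \<in> div_sheaf X (\<lambda>E. D E + D' E) (U \<inter> U')" by (auto simp: div_sheaf_def)
  moreover have "openin (zariski X) (U \<inter> U')" using U U' by (intro openin_Int)
  ultimately show ?thesis using U U' by (auto simp: stalk_def)
qed

text \<open>One inclusion is the description of \<open>x\<close> by the prime divisors through it,
  all of which lie in every open neighbourhood of \<open>x\<close>. For the other, the domain of
  definition of \<open>\<phi>\<close> is such a neighbourhood.\<close>

lemma stalk_div_sheaf_zero:
  assumes X: "normal_variety \<iota> X" "x \<in> X"
  shows "stalk X (div_sheaf X (\<lambda>_. 0)) x = x"
proof (intro equalityI subsetI)
  fix \<phi> assume "\<phi> \<in> stalk X (div_sheaf X (\<lambda>_. 0)) x"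
  then obtain U where U: "openin (zariski X) U" "x \<in> U" "\<phi> \<in> div_sheaf X (\<lambda>_. 0) U"
    by (auto simp: stalk_def)
  show "\<phi> \<in> x"
  proof (rule mem_point_if_mem_prime_divisors[OF X])
    fix E assume E: "prime_divisor X E" "x \<subseteq> E"
    then have "E \<in> U" using openin_zariski_generisation[OF U(1,2)] by (auto simp: prime_divisor_def)
    moreover have dv: "dvring E" using X(1) E(1) by (rule dvring_prime_divisor)
    ultimately show "\<phi> \<in> E"
      using U(3) E(1) dvring_mem_iff[OF dv, of \<phi>] unital_subring.zero_closed[OF unital_subring_dvring[OF dv]]
      by (auto simp: div_sheaf_def)
  qed
next
  fix \<phi> assume \<phi>: "\<phi> \<in> x"
  have "openin (zariski X) {z \<in> X. \<phi> \<in> z}"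
    unfolding zariski_def by (rule topology_generated_by_Basis) auto
  moreover have "\<phi> \<in> div_sheaf X (\<lambda>_. 0) {z \<in> X. \<phi> \<in> z}"
    using dvring_mem_iff[OF dvring_prime_divisor[OF X(1)]] by (auto simp: div_sheaf_def)
  ultimately show "\<phi> \<in> stalk X (div_sheaf X (\<lambda>_. 0)) x" using X \<phi> by (auto simp: stalk_def)
qed

lemma stalk_div_sheaf_power:
  assumes X: "normal_variety \<iota> X" "x \<in> X" and \<phi>: "\<phi> \<in> stalk X (div_sheaf X D) x"
  shows "\<phi> ^ n \<in> stalk X (div_sheaf X (\<lambda>E. int n * D E)) x"
proof (induction n)
  case 0
  then show ?case
    using stalk_div_sheaf_zero[OF X] unital_subring.one_closed[OF unital_subring_point[OF X]] by simp
next
  case (Suc n)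
  then show ?case using stalk_div_sheaf_mult[OF X(1) \<phi> Suc] by (simp add: algebra_simps)
qed

section \<open>Values of divisorial sheaves along divisors over the variety\<close>

lemma val_ideal_eq_stalk:
  assumes "normal_variety \<iota> X" "local_subring E" "x \<in> X" "dominates E x"
  shows "val_ideal X E \<I> = (LEAST k. \<exists>\<phi>\<in>stalk X \<I> x. \<phi> \<noteq> 0 \<and> k = val E \<phi>)"
proof -
  have center: "center_pt X E = x" using assms by (rule center_pt_eq)
  \<comment> \<open>An open set meets the closure of a point exactly when it contains the
    point.\<close>
  have meets: "openin (zariski X) U \<and> U \<inter> center X E \<noteq> {} \<and> Q \<longleftrightarrow>
      openin (zariski X) U \<and> x \<in> U \<and> Q" for U Q
    using openin_Int_closure_of_eq_empty[of "zariski X" U "{x}"]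
    by (auto simp: center_def center)
  show ?thesis
    unfolding val_ideal_def meets by (rule arg_cong[of _ _ Least]) (auto simp: stalk_def)
qed

text \<open>A nonzero local generator is a combination of germs that cannot all vanish. The germs
  obtained here are the starting point for the existence of least values.\<close>

lemma inverse_image_invertible_stalk_nonzero:
  assumes "inverse_image_invertible Y X \<F>" "y \<in> Y" "unital_subring y"
  obtains \<phi> where "\<phi> \<in> stalk X \<F> (center_pt X y)" "\<phi> \<noteq> 0"
proof -
  interpret unital_subring y by fact
  obtain g where g: "g \<noteq> 0" "inverse_image_stalk X \<F> y = (\<lambda>a. g * a) ` y"
    using assms(1,2) unfolding inverse_image_invertible_def by meson
  then have "g \<in> inverse_image_stalk X \<F> y" by (metis image_eqI mult.right_neutral one_closed)
  then obtain n :: nat and a s where as: "g = (\<Sum>i<n. a i * s i)"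
      "\<forall>i<n. s i \<in> stalk X \<F> (center_pt X y)"
    by (auto simp: inverse_image_stalk_def span_over_def)
  have "\<exists>i<n. s i \<noteq> 0"
  proof (rule ccontr)
    assume "\<not> (\<exists>i<n. s i \<noteq> 0)"
    then have "g = 0" using as(1) by simp
    then show False using g(1) by simp
  qed
  then show thesis using that as by blast
qed

context
  fixes \<iota> :: "complex \<Rightarrow> 'a::field" and X E x
  assumes X: "normal_variety \<iota> X" and E: "dvring E" and x: "x \<in> X" "dominates E x"
begin

text \<open>The product is a germ of the structure sheaf, so it belongs to \<open>x\<close> and to
  \<open>E\<close>. Asking only that the divisors add up to 0 lets either one take the first
  place.\<close>

lemma val_stalk_add_nonneg:
  assumes "\<phi> \<in> stalk X (div_sheaf X D) x" "\<phi> \<noteq> 0" "\<psi> \<in> stalk X (div_sheaf X D') x" "\<psi> \<noteq> 0"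
    and "\<And>z. D z + D' z = 0"
  shows "0 \<le> val E \<phi> + val E \<psi>"
proof -
  have "\<phi> * \<psi> \<in> x"
    using stalk_div_sheaf_mult[OF X assms(1,3)] assms(5) stalk_div_sheaf_zero[OF X x(1)] by simp
  then have "\<phi> * \<psi> \<in> E" using x(2) by (auto simp: dominates_def)
  then show ?thesis using dvring_mem_iff[OF E, of "\<phi> * \<psi>"] val_mult[OF E] assms by simp
qed

text \<open>A least integer exists only for values bounded below. A nonzero germ
  \<open>\<psi>\<close> of the opposite divisor gives the bound \<open>- val E \<psi>\<close>, and
  shifting by it reduces the minimum to natural numbers.\<close>

lemma val_ideal_div_sheaf_attained:
  assumes \<phi>: "\<phi> \<in> stalk X (div_sheaf X D) x" "\<phi> \<noteq> 0"
    and \<psi>: "\<psi> \<in> stalk X (div_sheaf X D') x" "\<psi> \<noteq> 0" and sum: "\<And>z. D z + D' z = 0"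
  obtains \<chi> where "\<chi> \<in> stalk X (div_sheaf X D) x" "\<chi> \<noteq> 0"
    "val_ideal X E (div_sheaf X D) = val E \<chi>"
proof -
  let ?Q = "\<lambda>\<chi>. \<chi> \<in> stalk X (div_sheaf X D) x \<and> \<chi> \<noteq> 0"
  have lb: "- val E \<psi> \<le> val E \<chi>" if "?Q \<chi>" for \<chi>
    using val_stalk_add_nonneg[of \<chi> D \<psi> D'] that \<psi> sum by simp
  obtain \<chi> where \<chi>: "?Q \<chi>" and
    min: "\<And>\<xi>. ?Q \<xi> \<Longrightarrow> nat (val E \<chi> + val E \<psi>) \<le> nat (val E \<xi> + val E \<psi>)"
    using ex_has_least_nat[of ?Q \<phi> "\<lambda>\<chi>. nat (val E \<chi> + val E \<psi>)"] \<phi> by blast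
  have "val E \<chi> \<le> val E \<xi>" if "?Q \<xi>" for \<xi> using min[OF that] lb[OF that] lb[OF \<chi>] by simp
  then have "val_ideal X E (div_sheaf X D) = val E \<chi>"
    unfolding val_ideal_eq_stalk[OF X dvring_local_subring[OF E] x]
    using \<chi> by (intro Least_equality) auto
  then show thesis using that \<chi> by blast
qed

text \<open>
  Equality in subadditivity: if the values of \<open>D\<close> and \<open>- D\<close> cancel, the value of \<open>n D\<close> is
  bounded from above by powers of \<open>\<phi>\<close> and from below by pairing with powers of \<open>\<psi>\<close>.
\<close>
lemma val_ideal_multiple:
  assumes \<phi>: "\<phi> \<in> stalk X (div_sheaf X D) x" "\<phi> \<noteq> 0"
    and \<psi>: "\<psi> \<in> stalk X (div_sheaf X D') x" "\<psi> \<noteq> 0" and sum: "\<And>z. D z + D' z = 0"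
    and opp: "val E \<phi> + val E \<psi> = 0"
  shows "val_ideal X E (div_sheaf X (\<lambda>z. int n * D z)) = int n * val E \<phi>"
  unfolding val_ideal_eq_stalk[OF X dvring_local_subring[OF E] x]
proof (rule Least_equality)
  have "\<phi> ^ n \<noteq> 0" "int n * val E \<phi> = val E (\<phi> ^ n)" using \<phi>(2) E by (simp_all add: val_power)
  then show "\<exists>\<chi>\<in>stalk X (div_sheaf X (\<lambda>z. int n * D z)) x. \<chi> \<noteq> 0 \<and> int n * val E \<phi> = val E \<chi>"
    using stalk_div_sheaf_power[OF X x(1) \<phi>(1)] by blast
next
  fix k assume "\<exists>\<chi>\<in>stalk X (div_sheaf X (\<lambda>z. int n * D z)) x. \<chi> \<noteq> 0 \<and> k = val E \<chi>"
  then obtain \<chi> where \<chi>: "\<chi> \<in> stalk X (div_sheaf X (\<lambda>z. int n * D z)) x" "\<chi> \<noteq> 0" "k = val E \<chi>"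
    by blast
  have "0 \<le> val E \<chi> + val E (\<psi> ^ n)"
    using \<chi>(2) \<psi>(2) sum
    by (intro val_stalk_add_nonneg[OF \<chi>(1) _ stalk_div_sheaf_power[OF X x(1) \<psi>(1)]])
      (auto simp flip: distrib_left)
  moreover have "val E (\<psi> ^ n) = - (int n * val E \<phi>)"
    using val_power[OF E \<psi>(2)] opp by (simp add: eq_neg_iff_add_eq_0 flip: distrib_left)
  ultimately show "int n * val E \<phi> \<le> k" using \<chi>(3) by simp
qed

end

section \<open>Trivial defect ideals\<close>

text \<open>\<open>F\<close> need not be a prime divisor of the resolution; the valuative criterion
  only gives a point \<open>y\<close> that it dominates. The inverse of \<open>g * h\<close> lies in
  \<open>y\<close>, hence in \<open>F\<close>, so some product of a germ of each sheaf avoids the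
  maximal ideal of \<open>F\<close>. Its value is at most 0, and pairing shows that it is at least
  0.\<close>

lemma defect_ideal_trivial_val:
  fixes \<iota> :: "complex \<Rightarrow> 'a::field"
  assumes X: "normal_variety \<iota> X" and m: "m \<ge> 1"
    and defect: "is_defect_ideal \<iota> X m D structure_sheaf"
    and F: "dvring F" and x: "x \<in> X" "dominates F x"
  obtains \<phi> \<psi> where "\<phi> \<in> stalk X (div_sheaf X (\<lambda>z. int m * D z)) x" "\<phi> \<noteq> 0"
    "\<psi> \<in> stalk X (div_sheaf X (\<lambda>z. - (int m * D z))) x" "\<psi> \<noteq> 0" "val F \<phi> + val F \<psi> = 0"
proof -
  let ?S = "div_sheaf X (\<lambda>z. int m * D z)" and ?T = "div_sheaf X (\<lambda>z. - (int m * D z))"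
  obtain Y where "log_resolution \<iota> Y X"
    and inv: "inverse_image_invertible Y X ?S" "inverse_image_invertible Y X ?T"
    and eq: "sheaf_eq X structure_sheaf (sheaf_pushforward Y X (div_sheaf Y (\<lambda>E.
          \<lfloor>of_int (- nat_pullback X (\<lambda>x. - (int m * D x)) E - nat_pullback X (\<lambda>x. int m * D x) E)
             / real m\<rfloor>)))"
    using defect by (auto simp: is_defect_ideal_def)
  then have Y: "normal_variety \<iota> Y" and f: "proper_birational Y X"
    by (auto simp: log_resolution_def)
  have image: "\<exists>x\<in>X. dominates y x \<and> center_pt X y = x" if "y \<in> Y" for y
    using f that center_pt_eq[OF X local_subring_point[OF Y that]]
    unfolding proper_birational_def by metis
  obtain y where y: "y \<in> Y" "dominates F y"
    using f x dvring_valuation_subring[OF F] unfolding proper_birational_def by blast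
  obtain x' where x': "x' \<in> X" "dominates y x'" "center_pt X y = x'" using image[OF y(1)] by blast
  have "x' = x"
    using center_pt_eq[OF X dvring_local_subring[OF F]] x x'(1) dominates_trans[OF y(2) x'(2)] by metis
  then have yx: "center_pt X y = x" using x' by simp
  interpret y: unital_subring y using Y y(1) by (rule unital_subring_point)
  obtain V g where g: "openin (zariski Y) V" "y \<in> V" "g \<noteq> 0"
      "\<forall>z\<in>V. inverse_image_stalk X ?S z = (\<lambda>a. g * a) ` z"
    using inv(1) y(1) unfolding inverse_image_invertible_def by meson
  obtain W h where h: "openin (zariski Y) W" "y \<in> W" "h \<noteq> 0"
      "\<forall>z\<in>W. inverse_image_stalk X ?T z = (\<lambda>a. h * a) ` z"
    using inv(2) y(1) unfolding inverse_image_invertible_def by meson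
  \<comment> \<open>Along each prime divisor \<open>E\<close> through \<open>y\<close>, germs of
    least value are multiples of \<open>g\<close> and of \<open>h\<close>, and by the triviality of
    the defect ideal their values have sum at most 0. So \<open>g * h\<close> has value at most 0 at
    \<open>E\<close>.\<close>
  have unit: "inverse (g * h) \<in> y"
  proof (rule mem_point_if_mem_prime_divisors[OF Y y(1)])
    fix E assume E: "prime_divisor Y E" "y \<subseteq> E"
    then have EY: "E \<in> Y" by (simp add: prime_divisor_def)
    have dv: "dvring E" using Y E(1) by (rule dvring_prime_divisor)
    interpret E: unital_subring E using dv by (rule unital_subring_dvring)
    obtain e where e: "e \<in> X" "dominates E e" "center_pt X E = e" using image[OF EY] by blast
    obtain \<phi>0 where \<phi>0: "\<phi>0 \<in> stalk X ?S e" "\<phi>0 \<noteq> 0"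
      using inverse_image_invertible_stalk_nonzero[OF inv(1) EY E.unital_subring_axioms] e(3) by metis
    obtain \<psi>0 where \<psi>0: "\<psi>0 \<in> stalk X ?T e" "\<psi>0 \<noteq> 0"
      using inverse_image_invertible_stalk_nonzero[OF inv(2) EY E.unital_subring_axioms] e(3) by metis
    obtain \<phi> where \<phi>: "\<phi> \<in> stalk X ?S e" "\<phi> \<noteq> 0" "val_ideal X E ?S = val E \<phi>"
      by (rule val_ideal_div_sheaf_attained[OF X dv e(1,2) \<phi>0 \<psi>0]) auto
    obtain \<psi> where \<psi>: "\<psi> \<in> stalk X ?T e" "\<psi> \<noteq> 0" "val_ideal X E ?T = val E \<psi>"
      by (rule val_ideal_div_sheaf_attained[OF X dv e(1,2) \<psi>0 \<phi>0]) auto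
    \<comment> \<open>As a section of the pushforward, 1 obeys the condition at \<open>E\<close>.
      Since its value is 0, the floor is nonnegative, and so is the number under it.\<close>
    have "1 \<in> structure_sheaf X"
      using unital_subring.one_closed[OF unital_subring_point[OF X]] by (auto simp: structure_sheaf_def)
    then have "0 \<le> val E 1 +
        \<lfloor>of_int (- nat_pullback X (\<lambda>x. - (int m * D x)) E - nat_pullback X (\<lambda>x. int m * D x) E) / real m\<rfloor>"
      using eq openin_zariski_space[OF X] x(1) E(1) EY e
      by (auto simp: sheaf_eq_def sheaf_pushforward_def div_sheaf_def)
    then have "0 \<le> real_of_int (- nat_pullback X (\<lambda>x. - (int m * D x)) E - nat_pullback X (\<lambda>x. int m * D x) E)"
      using m by (simp add: val_one[OF dv] zero_le_divide_iff)
    then have le: "val E \<phi> + val E \<psi> \<le> 0"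
      using \<phi>(3) \<psi>(3) by (simp add: nat_pullback_def)
    have span: "\<chi> \<in> inverse_image_stalk X \<F> E" if "\<chi> \<in> stalk X \<F> e" for \<chi> \<F>
    proof -
      have "\<chi> = (\<Sum>i<Suc 0. 1 * \<chi>)" by simp
      then show ?thesis using that E.one_closed e(3) unfolding inverse_image_stalk_def span_over_def
        by (intro CollectI exI[of _ "Suc 0"] exI[of _ "\<lambda>_. 1"] exI[of _ "\<lambda>_. \<chi>"]) auto
    qed
    have "E \<in> V" "E \<in> W" using openin_zariski_generisation g(1,2) h(1,2) E(2) EY by metis+
    then obtain a b where ab: "a \<in> E" "b \<in> E" "\<phi> = g * a" "\<psi> = h * b"
      using span[OF \<phi>(1)] span[OF \<psi>(1)] g(4) h(4) by auto
    then have "a \<noteq> 0" "b \<noteq> 0" using \<phi>(2) \<psi>(2) by auto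
    then have "val E (g * h) \<le> 0"
      using le ab g(3) h(3) dvring_mem_iff[OF dv] by (fastforce simp: val_mult[OF dv])
    then show "inverse (g * h) \<in> E"
      using dvring_mem_iff[OF dv, of "inverse (g * h)"] val_inverse[OF dv, of "g * h"] g(3) h(3)
      by simp
  qed
  have max: "ideal_in (max_ideal F) F" using F by (rule ideal_in_max_ideal_dvring)
  have yF: "y \<subseteq> F" using y(2) by (simp add: dominates_def)
  \<comment> \<open>Since \<open>y\<close> is contained in \<open>F\<close>, the property passes
    from generators to their span. Using it once for each sheaf reduces \<open>g * h\<close> to
    products of germs.\<close>
  have span: "s * t \<in> max_ideal F"
    if s_span: "s \<in> span_over y S" and S: "\<And>u. u \<in> S \<Longrightarrow> u * t \<in> max_ideal F" for s t S
  proof -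
    obtain n :: nat and a u where s: "s = (\<Sum>i<n. a i * u i)" "\<forall>i<n. a i \<in> y \<and> u i \<in> S"
      using s_span by (auto simp: span_over_def)
    then have "s * t = (\<Sum>i<n. a i * (u i * t))" by (simp add: sum_distrib_right mult.assoc)
    also have "\<dots> \<in> max_ideal F"
    proof (rule ideal_in_sum[OF max])
      fix i assume "i \<in> {..<n}"
      then have "a i \<in> F" "u i * t \<in> max_ideal F" using s(2) yF S by auto
      then show "a i * (u i * t) \<in> max_ideal F" using max unfolding ideal_in_def by blast
    qed
    finally show ?thesis .
  qed
  have gh: "g \<in> span_over y (stalk X ?S x)" "h \<in> span_over y (stalk X ?T x)"
    using g(2,4) h(2,4) y.one_closed unfolding inverse_image_stalk_def yx[symmetric]
    by (metis image_eqI mult.right_neutral)+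
  have "\<exists>\<phi>\<in>stalk X ?S x. \<exists>\<psi>\<in>stalk X ?T x. \<phi> * \<psi> \<notin> max_ideal F"
  proof (rule ccontr)
    assume "\<not> ?thesis"
    then have prod: "\<psi> * \<phi> \<in> max_ideal F" if "\<phi> \<in> stalk X ?S x" "\<psi> \<in> stalk X ?T x" for \<phi> \<psi>
      using that by (metis mult.commute)
    have "h * \<phi> \<in> max_ideal F" if "\<phi> \<in> stalk X ?S x" for \<phi>
      using gh(2) prod[OF that] by (rule span)
    then have "g * h \<in> max_ideal F" by (intro span[OF gh(1)]) (simp add: mult.commute)
    then show False using unit yF g(3) h(3) by (auto simp: max_ideal_eq)
  qed
  then obtain \<phi> \<psi> where \<phi>\<psi>: "\<phi> \<in> stalk X ?S x" "\<psi> \<in> stalk X ?T x" "\<phi> * \<psi> \<notin> max_ideal F" by blast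
  then have nz: "\<phi> \<noteq> 0" "\<psi> \<noteq> 0" using max by (auto simp: ideal_in_def)
  have "val F \<phi> + val F \<psi> \<le> 0"
    using \<phi>\<psi>(3) dvring_max_ideal_iff[OF F, of "\<phi> * \<psi>"] nz by (simp add: val_mult[OF F])
  moreover have "0 \<le> val F \<phi> + val F \<psi>"
    by (rule val_stalk_add_nonneg[OF X F x \<phi>\<psi>(1) nz(1) \<phi>\<psi>(2) nz(2)]) simp
  ultimately show thesis using that \<phi>\<psi>(1,2) nz by force
qed

text \<open>Let \<open>v\<close> be the value at \<open>F\<close> of the sheaf of
  \<open>m * KX\<close>. The opposite sheaf has value \<open>- v\<close>, and multiples have
  proportional values, so both sides are \<open>KY F + v / m\<close>, whatever \<open>KY\<close>
  is.\<close>

lemma K_minus_eq_K_plus: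
  assumes X: "normal_variety \<iota> X" and m: "m \<ge> 1"
    and defect: "is_defect_ideal \<iota> X m KX structure_sheaf"
    and F: "dvring F" and x: "x \<in> X" "dominates F x"
  shows "K_minus X m KX KY F = K_plus X KX KY F"
proof -
  obtain \<phi> \<psi> where \<phi>: "\<phi> \<in> stalk X (div_sheaf X (\<lambda>z. int m * KX z)) x" "\<phi> \<noteq> 0"
    and \<psi>: "\<psi> \<in> stalk X (div_sheaf X (\<lambda>z. - (int m * KX z))) x" "\<psi> \<noteq> 0"
    and opp: "val F \<phi> + val F \<psi> = 0"
    using X m defect F x by (rule defect_ideal_trivial_val)
  have mult: "val_ideal X F (div_sheaf X (\<lambda>z. int j * (int m * KX z))) = int j * val F \<phi>" for j
    using \<phi> \<psi> opp by (intro val_ideal_multiple[OF X F x]) auto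
  \<comment> \<open>The germs change roles because \<open>nat_pullback\<close> evaluates the sheaf
    of the negative divisor.\<close>
  have minus: "nat_pullback X (\<lambda>z. int m * KX z) F = - val F \<phi>"
    using val_ideal_multiple[OF X F x \<psi> \<phi>, of 1] opp by (simp add: nat_pullback_def)
  \<comment> \<open>From \<open>k = m\<close> on, \<open>m\<close> divides \<open>fact k\<close>.
    The two minus signs, one from the definition of \<open>pullback\<close> and one from
    \<open>- KX\<close>, cancel, leaving a multiple of \<open>m * KX\<close>.\<close>
  have "of_int (val_ideal X F (div_sheaf X (\<lambda>z. - (int (fact k) * - KX z)))) / fact k
      = of_int (val F \<phi>) / real m" if km: "k \<ge> m" for k
  proof -
    obtain j where j: "fact k = m * j" using dvd_fact[OF m km] by (auto simp: dvd_def)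
    then have "j \<noteq> 0" by (metis fact_nonzero mult_0_right)
    have "fact k = real m * real j" using j by (metis of_nat_fact of_nat_mult)
    moreover have "(\<lambda>z. - (int (fact k) * - KX z)) = (\<lambda>z. int j * (int m * KX z))"
      unfolding j by (simp add: mult_ac)
    ultimately show ?thesis using mult[of j] m \<open>j \<noteq> 0\<close> by simp
  qed
  then have "pullback X (\<lambda>z. - KX z) F = of_int (val F \<phi>) / real m"
    unfolding pullback_def
    by (intro limI tendsto_eventually eventually_sequentiallyI[of m])
  then show ?thesis by (simp add: K_minus_def K_plus_def minus)
qed

theorem theorem1p2:
  fixes \<iota> :: "complex \<Rightarrow> 'a::field"
    and X :: "'a model"
    and KX :: "'a point \<Rightarrow> int"
  assumes "normal_variety \<iota> X"
    and "canonical_divisor \<iota> X KX"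
    and "lt_plus \<iota> X KX"
    and "is_stable_defect_ideal \<iota> X KX structure_sheaf"
  shows "klt \<iota> X KX"
proof -
  \<comment> \<open>The bound of divisibility is itself an admissible order. This one
    \<open>m\<close> serves all \<open>Y\<close> and \<open>F\<close>, as \<open>klt\<close>
    demands.\<close>
  obtain m where m: "m \<ge> 1" "is_defect_ideal \<iota> X m KX structure_sheaf"
    using assms(4) unfolding is_stable_defect_ideal_def by (meson dvd_refl)
  have "K_minus X m KX KY F > -1"
    if Y: "normal_variety \<iota> Y" "proper_birational Y X" "canonical_divisor \<iota> Y KY"
      "div_pushforward X KY = KX" "exceptional_divisor Y X F" for Y KY F
  proof -
    have F: "prime_divisor Y F" using Y(5) by (simp add: exceptional_divisor_def)
    then obtain x where "x \<in> X" "dominates F x"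
      using Y(2) unfolding proper_birational_def prime_divisor_def by meson
    then have "K_minus X m KX KY F = K_plus X KX KY F"
      using assms(1) m dvring_prime_divisor[OF Y(1) F] by (intro K_minus_eq_K_plus)
    then show ?thesis using assms(3) Y unfolding lt_plus_def by metis
  qed
  then show ?thesis using m(1) unfolding klt_def by blast
qed

end
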